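(* Let $\mathbb{C}$ be a small category and let $p:\dot{\mathcal{U}}\to\mathcal{U}$ be a natural transformation between presheaves over $\mathbb{C}$. (a) If $p$ is representable, then its extension $\mathrm{P}_p:\widehat{\mathbb{C}}\to\widehat{\mathbb{C}}$ is cocontinuous. (b) If the extension $\mathrm{P}_p:\widehat{\mathbb{C}}\to\widehat{\mathbb{C}}$ is cocontinuous and $\mathbb{C}$ is Cauchy complete with finite products, then $p$ is representable.
   Context: $\widehat{\mathbb{C}}=\mathbf{Set}^{\mathbb{C}^{\mathrm{op}}}$ and $\mathsf{y}$ is the Yoneda embedding. A natural transformation $p:\dot{\mathcal{U}}\to\mathcal{U}$ is representable if for every object $\Gamma$ of $\mathbb{C}$ and every $A:\mathsf{y}(\Gamma)\to\mathcal{U}$, the pullback $\mathsf{y}(\Gamma)\times_{\mathcal{U}}\dot{\mathcal{U}}$ is isomorphic to a representable presheaf. The extension of $p$ is the polynomial functor $\mathrm{P}_p:\widehat{\mathbb{C}}\to\widehat{\mathbb{C}}$, $\mathrm{P}_p(X)=\sum_{A\in\mathcal{U}}X^{\dot{\mathcal{U}}_A}$, i.e. the composite $\widehat{\mathbb{C}}\xrightarrow{(-)\times\dot{\mathcal{U}}}\widehat{\mathbb{C}}/\dot{\mathcal{U}}\xrightarrow{\Pi_p}\widehat{\mathbb{C}}/\mathcal{U}\to\widehat{\mathbb{C}}$, where $\Pi_p$ is the right adjoint of pullback along $p$ and the last functor is the forgetful (domain) functor. A category is Cauchy complete if every idempotent in it splits. Cocontinuous means preserving all small colimits. *)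

theory Defs
  imports Main "HOL-Library.FuncSet"
begin

unbundle cardinal_syntax

section \<open>Categories and functors\<close>

record ('o, 'a) cat =
  Obj :: "'o set"
  Arr :: "'a set"
  Dom :: "'a \<Rightarrow> 'o"
  Cod :: "'a \<Rightarrow> 'o"
  Ide :: "'o \<Rightarrow> 'a"
  Comp :: "'a \<Rightarrow> 'a \<Rightarrow> 'a"

definition hom :: "('o, 'a) cat \<Rightarrow> 'o \<Rightarrow> 'o \<Rightarrow> 'a set" where
  "hom C x y = {f \<in> Arr C. Dom C f = x \<and> Cod C f = y}"

text \<open>\<open>Comp C g f\<close> is the composite of \<open>f\<close> followed by \<open>g\<close>. Its value is irrelevant
  when \<open>g\<close> and \<open>f\<close> are not composable arrows.\<close>

locale category =
  fixes C :: "('o, 'a) cat"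
  assumes Dom_Obj: "f \<in> Arr C \<Longrightarrow> Dom C f \<in> Obj C"
    and Cod_Obj: "f \<in> Arr C \<Longrightarrow> Cod C f \<in> Obj C"
    and Ide_hom: "x \<in> Obj C \<Longrightarrow> Ide C x \<in> hom C x x"
    and Comp_hom: "f \<in> hom C x y \<Longrightarrow> g \<in> hom C y z \<Longrightarrow> Comp C g f \<in> hom C x z"
    and Comp_Ide_left: "f \<in> hom C x y \<Longrightarrow> Comp C (Ide C y) f = f"
    and Comp_Ide_right: "f \<in> hom C x y \<Longrightarrow> Comp C f (Ide C x) = f"
    and Comp_assoc: "f \<in> hom C w x \<Longrightarrow> g \<in> hom C x y \<Longrightarrow> h \<in> hom C y z \<Longrightarrow>
      Comp C h (Comp C g f) = Comp C (Comp C h g) f"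

definition opposite :: "('o, 'a) cat \<Rightarrow> ('o, 'a) cat" where
  "opposite C = \<lparr>Obj = Obj C, Arr = Arr C, Dom = Cod C, Cod = Dom C, Ide = Ide C,
    Comp = (\<lambda>g f. Comp C f g)\<rparr>"

text \<open>The maps of functors and natural transformations are required to be extensional (equal to
  \<open>undefined\<close> off their domains), so that HOL equality is equality of functors, respectively of
  natural transformations.\<close>

record ('o, 'a, 'p, 'b) fctr =
  fobj :: "'o \<Rightarrow> 'p"
  farr :: "'a \<Rightarrow> 'b"

definition is_functor :: "('o, 'a) cat \<Rightarrow> ('p, 'b) cat \<Rightarrow> ('o, 'a, 'p, 'b) fctr \<Rightarrow> bool" where
  "is_functor C D F \<longleftrightarrow> category C \<and> category D \<and>
    fobj F \<in> Obj C \<rightarrow>\<^sub>E Obj D \<and> farr F \<in> Arr C \<rightarrow>\<^sub>E Arr D \<and>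
    (\<forall>x y. \<forall>f \<in> hom C x y. farr F f \<in> hom D (fobj F x) (fobj F y)) \<and>
    (\<forall>x \<in> Obj C. farr F (Ide C x) = Ide D (fobj F x)) \<and>
    (\<forall>x y z. \<forall>f \<in> hom C x y. \<forall>g \<in> hom C y z.
      farr F (Comp C g f) = Comp D (farr F g) (farr F f))"

definition fcomp :: "('o, 'a) cat \<Rightarrow> ('p, 'b, 'q, 'c) fctr \<Rightarrow> ('o, 'a, 'p, 'b) fctr
    \<Rightarrow> ('o, 'a, 'q, 'c) fctr" where
  "fcomp C G F = \<lparr>fobj = (\<lambda>x \<in> Obj C. fobj G (fobj F x)),
    farr = (\<lambda>f \<in> Arr C. farr G (farr F f))\<rparr>"

record ('o, 'a, 'p, 'b) nat_trans =
  nt_dom :: "('o, 'a, 'p, 'b) fctr"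
  nt_cod :: "('o, 'a, 'p, 'b) fctr"
  nt_at :: "'o \<Rightarrow> 'b"

definition is_nat_trans :: "('o, 'a) cat \<Rightarrow> ('p, 'b) cat \<Rightarrow> ('o, 'a, 'p, 'b) nat_trans \<Rightarrow> bool" where
  "is_nat_trans C D t \<longleftrightarrow> is_functor C D (nt_dom t) \<and> is_functor C D (nt_cod t) \<and>
    nt_at t \<in> (\<Pi>\<^sub>E x \<in> Obj C. hom D (fobj (nt_dom t) x) (fobj (nt_cod t) x)) \<and>
    (\<forall>x y. \<forall>f \<in> hom C x y.
      Comp D (farr (nt_cod t) f) (nt_at t x) = Comp D (nt_at t y) (farr (nt_dom t) f))"

definition functor_cat :: "('o, 'a) cat \<Rightarrow> ('p, 'b) cat
    \<Rightarrow> (('o, 'a, 'p, 'b) fctr, ('o, 'a, 'p, 'b) nat_trans) cat" where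
  "functor_cat C D = \<lparr>Obj = {F. is_functor C D F}, Arr = {t. is_nat_trans C D t},
    Dom = nt_dom, Cod = nt_cod,
    Ide = (\<lambda>F. \<lparr>nt_dom = F, nt_cod = F, nt_at = (\<lambda>x \<in> Obj C. Ide D (fobj F x))\<rparr>),
    Comp = (\<lambda>s t. \<lparr>nt_dom = nt_dom t, nt_cod = nt_cod s,
      nt_at = (\<lambda>x \<in> Obj C. Comp D (nt_at s x) (nt_at t x))\<rparr>)\<rparr>"

section \<open>Isomorphisms, idempotents, limits and colimits\<close>

definition isomorphic :: "('o, 'a) cat \<Rightarrow> 'o \<Rightarrow> 'o \<Rightarrow> bool" where
  "isomorphic C x y \<longleftrightarrow> (\<exists>f \<in> hom C x y. \<exists>g \<in> hom C y x.
    Comp C g f = Ide C x \<and> Comp C f g = Ide C y)"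

definition cauchy_complete :: "('o, 'a) cat \<Rightarrow> bool" where
  "cauchy_complete C \<longleftrightarrow> (\<forall>x \<in> Obj C. \<forall>e \<in> hom C x x. Comp C e e = e \<longrightarrow>
    (\<exists>y \<in> Obj C. \<exists>r \<in> hom C x y. \<exists>s \<in> hom C y x. Comp C r s = Ide C y \<and> Comp C s r = e))"

definition is_product :: "('o, 'a) cat \<Rightarrow> 'i set \<Rightarrow> ('i \<Rightarrow> 'o) \<Rightarrow> 'o \<Rightarrow> ('i \<Rightarrow> 'a) \<Rightarrow> bool" where
  "is_product C I X w \<pi> \<longleftrightarrow> w \<in> Obj C \<and> (\<forall>i \<in> I. X i \<in> Obj C \<and> \<pi> i \<in> hom C w (X i)) \<and>
    (\<forall>z \<in> Obj C. \<forall>q. (\<forall>i \<in> I. q i \<in> hom C z (X i)) \<longrightarrow>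
      (\<exists>!u. u \<in> hom C z w \<and> (\<forall>i \<in> I. Comp C (\<pi> i) u = q i)))"

definition has_finite_products :: "('o, 'a) cat \<Rightarrow> bool" where
  "has_finite_products C \<longleftrightarrow> (\<forall>(n::nat) X. (\<forall>i < n. X i \<in> Obj C) \<longrightarrow>
    (\<exists>w \<pi>. is_product C {..<n} X w \<pi>))"

definition is_binary_product :: "('o, 'a) cat \<Rightarrow> 'o \<Rightarrow> 'o \<Rightarrow> 'o \<Rightarrow> 'a \<Rightarrow> 'a \<Rightarrow> bool" where
  "is_binary_product C x y w \<pi>\<^sub>1 \<pi>\<^sub>2 \<longleftrightarrow>
    x \<in> Obj C \<and> y \<in> Obj C \<and> w \<in> Obj C \<and> \<pi>\<^sub>1 \<in> hom C w x \<and> \<pi>\<^sub>2 \<in> hom C w y \<and>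
    (\<forall>z \<in> Obj C. \<forall>q\<^sub>1 \<in> hom C z x. \<forall>q\<^sub>2 \<in> hom C z y.
      \<exists>!u. u \<in> hom C z w \<and> Comp C \<pi>\<^sub>1 u = q\<^sub>1 \<and> Comp C \<pi>\<^sub>2 u = q\<^sub>2)"

text \<open>The square with sides \<open>\<pi>\<^sub>1 : w \<rightarrow> Dom f\<close>, \<open>\<pi>\<^sub>2 : w \<rightarrow> Dom g\<close> over the cospan \<open>f\<close>, \<open>g\<close>.\<close>

definition is_pullback :: "('o, 'a) cat \<Rightarrow> 'a \<Rightarrow> 'a \<Rightarrow> 'o \<Rightarrow> 'a \<Rightarrow> 'a \<Rightarrow> bool" where
  "is_pullback C f g w \<pi>\<^sub>1 \<pi>\<^sub>2 \<longleftrightarrow>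
    f \<in> Arr C \<and> g \<in> Arr C \<and> Cod C f = Cod C g \<and> w \<in> Obj C \<and>
    \<pi>\<^sub>1 \<in> hom C w (Dom C f) \<and> \<pi>\<^sub>2 \<in> hom C w (Dom C g) \<and> Comp C f \<pi>\<^sub>1 = Comp C g \<pi>\<^sub>2 \<and>
    (\<forall>z \<in> Obj C. \<forall>q\<^sub>1 \<in> hom C z (Dom C f). \<forall>q\<^sub>2 \<in> hom C z (Dom C g).
      Comp C f q\<^sub>1 = Comp C g q\<^sub>2 \<longrightarrow>
      (\<exists>!u. u \<in> hom C z w \<and> Comp C \<pi>\<^sub>1 u = q\<^sub>1 \<and> Comp C \<pi>\<^sub>2 u = q\<^sub>2))"

definition is_cocone :: "('j, 'k) cat \<Rightarrow> ('o, 'a) cat \<Rightarrow> ('j, 'k, 'o, 'a) fctr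
    \<Rightarrow> 'o \<Rightarrow> ('j \<Rightarrow> 'a) \<Rightarrow> bool" where
  "is_cocone J C D x \<iota> \<longleftrightarrow> is_functor J C D \<and> x \<in> Obj C \<and>
    (\<forall>j \<in> Obj J. \<iota> j \<in> hom C (fobj D j) x) \<and>
    (\<forall>i j. \<forall>k \<in> hom J i j. Comp C (\<iota> j) (farr D k) = \<iota> i)"

definition is_colimit :: "('j, 'k) cat \<Rightarrow> ('o, 'a) cat \<Rightarrow> ('j, 'k, 'o, 'a) fctr
    \<Rightarrow> 'o \<Rightarrow> ('j \<Rightarrow> 'a) \<Rightarrow> bool" where
  "is_colimit J C D x \<iota> \<longleftrightarrow> is_cocone J C D x \<iota> \<and>
    (\<forall>z \<kappa>. is_cocone J C D z \<kappa> \<longrightarrow>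
      (\<exists>!u. u \<in> hom C x z \<and> (\<forall>j \<in> Obj J. Comp C u (\<iota> j) = \<kappa> j)))"

definition preserves_colimits :: "('j, 'k) cat \<Rightarrow> ('o, 'a) cat \<Rightarrow> ('p, 'b) cat
    \<Rightarrow> ('o, 'a, 'p, 'b) fctr \<Rightarrow> bool" where
  "preserves_colimits J A B F \<longleftrightarrow> (\<forall>D x \<iota>. is_colimit J A D x \<iota> \<longrightarrow>
    is_colimit J B (fcomp J F D) (fobj F x) (\<lambda>j. farr F (\<iota> j)))"

section \<open>Adjunctions and slices\<close>

definition adjunction :: "('o, 'a) cat \<Rightarrow> ('p, 'b) cat \<Rightarrow> ('o, 'a, 'p, 'b) fctr
    \<Rightarrow> ('p, 'b, 'o, 'a) fctr \<Rightarrow> bool" where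
  "adjunction A B L R \<longleftrightarrow> is_functor A B L \<and> is_functor B A R \<and>
    (\<exists>\<phi>. (\<forall>a \<in> Obj A. \<forall>b \<in> Obj B.
            bij_betw (\<phi> a b) (hom B (fobj L a) b) (hom A a (fobj R b))) \<and>
         (\<forall>a a' b b'. \<forall>h \<in> hom A a' a. \<forall>k \<in> hom B b b'. \<forall>f \<in> hom B (fobj L a) b.
            \<phi> a' b' (Comp B k (Comp B f (farr L h))) =
              Comp A (farr R k) (Comp A (\<phi> a b f) h)))"

record 'a slice_arr =
  sl_dom :: 'a
  sl_cod :: 'a
  sl_map :: 'a

definition slice :: "('o, 'a) cat \<Rightarrow> 'o \<Rightarrow> ('a, 'a slice_arr) cat" where
  "slice C x = \<lparr>Obj = {f \<in> Arr C. Cod C f = x},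
    Arr = {h. sl_dom h \<in> Arr C \<and> Cod C (sl_dom h) = x \<and> sl_cod h \<in> Arr C \<and> Cod C (sl_cod h) = x \<and>
      sl_map h \<in> hom C (Dom C (sl_dom h)) (Dom C (sl_cod h)) \<and>
      Comp C (sl_cod h) (sl_map h) = sl_dom h},
    Dom = sl_dom, Cod = sl_cod,
    Ide = (\<lambda>f. \<lparr>sl_dom = f, sl_cod = f, sl_map = Ide C (Dom C f)\<rparr>),
    Comp = (\<lambda>k h. \<lparr>sl_dom = sl_dom h, sl_cod = sl_cod k, sl_map = Comp C (sl_map k) (sl_map h)\<rparr>)\<rparr>"

definition slice_forget :: "('o, 'a) cat \<Rightarrow> 'o \<Rightarrow> ('a, 'a slice_arr, 'o, 'a) fctr" where
  "slice_forget C x = \<lparr>fobj = (\<lambda>f \<in> Obj (slice C x). Dom C f),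
    farr = (\<lambda>h \<in> Arr (slice C x). sl_map h)\<rparr>"

text \<open>\<open>F\<close> is a functor \<open>C \<rightarrow> C/y\<close> sending each \<open>x\<close> to the second projection of some product of
  \<open>x\<close> and \<open>y\<close>, and acting on arrows by the universal property.\<close>

definition is_product_functor :: "('o, 'a) cat \<Rightarrow> 'o \<Rightarrow> ('o, 'a, 'a, 'a slice_arr) fctr \<Rightarrow> bool" where
  "is_product_functor C y F \<longleftrightarrow> is_functor C (slice C y) F \<and>
    (\<exists>\<pi>. (\<forall>x \<in> Obj C. is_binary_product C x y (Dom C (fobj F x)) (\<pi> x) (fobj F x)) \<and>
         (\<forall>x x'. \<forall>f \<in> hom C x x'. Comp C (\<pi> x') (sl_map (farr F f)) = Comp C f (\<pi> x)))"

text \<open>\<open>F\<close> is a functor \<open>C/Cod p \<rightarrow> C/Dom p\<close> sending each \<open>a\<close> to the projection to \<open>Dom p\<close> of some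
  pullback of \<open>a\<close> and \<open>p\<close>, and acting on arrows by the universal property.\<close>

definition is_pullback_functor :: "('o, 'a) cat \<Rightarrow> 'a
    \<Rightarrow> ('a, 'a slice_arr, 'a, 'a slice_arr) fctr \<Rightarrow> bool" where
  "is_pullback_functor C p F \<longleftrightarrow> is_functor (slice C (Cod C p)) (slice C (Dom C p)) F \<and>
    (\<exists>\<pi>. (\<forall>a \<in> Obj (slice C (Cod C p)). is_pullback C a p (Dom C (fobj F a)) (\<pi> a) (fobj F a)) \<and>
         (\<forall>a b. \<forall>h \<in> hom (slice C (Cod C p)) a b.
            Comp C (\<pi> b) (sl_map (farr F h)) = Comp C (sl_map h) (\<pi> a)))"

text \<open>The composite \<open>C \<rightarrow> C/Dom p \<rightarrow> C/Cod p \<rightarrow> C\<close> of the product functor, a right adjoint \<open>R\<close> of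
  pullback along \<open>p\<close>, and the forgetful functor. It is determined by \<open>p\<close> up to the choice of
  products, pullbacks and adjoint, hence up to natural isomorphism.\<close>

definition is_extension :: "('o, 'a) cat \<Rightarrow> 'a \<Rightarrow> ('o, 'a, 'o, 'a) fctr \<Rightarrow> bool" where
  "is_extension C p P \<longleftrightarrow> p \<in> Arr C \<and>
    (\<exists>F L R. is_product_functor C (Dom C p) F \<and> is_pullback_functor C p L \<and>
      adjunction (slice C (Cod C p)) (slice C (Dom C p)) L R \<and>
      P = fcomp C (slice_forget C (Cod C p)) (fcomp C R F))"

section \<open>Sets and presheaves\<close>

text \<open>Size. The elements of sets are drawn from a type \<open>'v\<close>, and a set of elements of \<open>'v\<close> is
  small if its cardinality is less than that of \<open>'v\<close>. If \<open>'v\<close> has inaccessible cardinality, this is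
  the category of sets of a Grothendieck universe. HOL does not prove that such a type exists; what
  is needed is only that the cardinality of \<open>'v\<close> is infinite and regular, i.e. that small unions of
  small sets are small. For every infinite type \<open>'a\<close>, the type \<open>'a suc\<close> of the library is an
  uncountable example. Inaccessibility would moreover give all exponentials of presheaves, hence an
  extension of every \<open>p\<close>; in general the existence of the right adjoint is part of the
  hypothesis \<open>is_extension\<close>.\<close>

definition small :: "'v set \<Rightarrow> bool" where
  "small A \<longleftrightarrow> |A| <o |UNIV :: 'v set|"

record 'v set_map =
  sm_dom :: "'v set"
  sm_cod :: "'v set"
  sm_fun :: "'v \<Rightarrow> 'v"

definition Set_cat :: "('v set, 'v set_map) cat" where
  "Set_cat = \<lparr>Obj = {A. small A},
    Arr = {f. small (sm_dom f) \<and> small (sm_cod f) \<and> sm_fun f \<in> sm_dom f \<rightarrow>\<^sub>E sm_cod f},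
    Dom = sm_dom, Cod = sm_cod,
    Ide = (\<lambda>A. \<lparr>sm_dom = A, sm_cod = A, sm_fun = (\<lambda>x \<in> A. x)\<rparr>),
    Comp = (\<lambda>g f. \<lparr>sm_dom = sm_dom f, sm_cod = sm_cod g,
      sm_fun = compose (sm_dom f) (sm_fun g) (sm_fun f)\<rparr>)\<rparr>"

definition small_category :: "('v, 'v) cat \<Rightarrow> bool" where
  "small_category C \<longleftrightarrow> category C \<and> small (Obj C) \<and> small (Arr C)"

type_synonym 'v presheaf = "('v, 'v, 'v set, 'v set_map) fctr"
type_synonym 'v presheaf_map = "('v, 'v, 'v set, 'v set_map) nat_trans"

definition PSh :: "('v, 'v) cat \<Rightarrow> ('v presheaf, 'v presheaf_map) cat" where
  "PSh C = functor_cat (opposite C) Set_cat"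

definition yoneda :: "('v, 'v) cat \<Rightarrow> 'v \<Rightarrow> 'v presheaf" where
  "yoneda C c = \<lparr>fobj = (\<lambda>d \<in> Obj C. hom C d c),
    farr = (\<lambda>f \<in> Arr C. \<lparr>sm_dom = hom C (Cod C f) c, sm_cod = hom C (Dom C f) c,
      sm_fun = (\<lambda>g \<in> hom C (Cod C f) c. Comp C g f)\<rparr>)\<rparr>"

definition representable :: "('v, 'v) cat \<Rightarrow> 'v presheaf_map \<Rightarrow> bool" where
  "representable C p \<longleftrightarrow>
    (\<forall>c \<in> Obj C. \<forall>A \<in> hom (PSh C) (yoneda C c) (Cod (PSh C) p).
      \<exists>E \<pi>\<^sub>1 \<pi>\<^sub>2. is_pullback (PSh C) A p E \<pi>\<^sub>1 \<pi>\<^sub>2 \<and>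
        (\<exists>d \<in> Obj C. isomorphic (PSh C) E (yoneda C d)))"

definition cocontinuous :: "('v, 'v) cat
    \<Rightarrow> ('v presheaf, 'v presheaf_map, 'v presheaf, 'v presheaf_map) fctr \<Rightarrow> bool" where
  "cocontinuous C P \<longleftrightarrow> is_functor (PSh C) (PSh C) P \<and>
    (\<forall>J :: ('v, 'v) cat. small_category J \<longrightarrow> preserves_colimits J (PSh C) (PSh C) P)"

end

theory Submission
  imports Defs
begin

text \<open>Write \<open>p : V \<rightarrow> U\<close>. Adjointness and the Yoneda lemma give
  \<open>P\<^sub>p(X)(c) \<cong> \<Sum>\<^sub>A Hom(E\<^sub>A, X)\<close>, where \<open>A\<close> ranges over the maps \<open>y(c) \<rightarrow> U\<close> and
  \<open>E\<^sub>A = y(c) \<times>\<^sub>U V\<close>, naturally in \<open>X\<close> and compatibly with the projection to \<open>U(c)\<close>. If every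
  \<open>E\<^sub>A\<close> is representable, say \<open>E\<^sub>A \<cong> y(d)\<close>, the summands \<open>Hom(E\<^sub>A, X) \<cong> X(d)\<close> preserve
  colimits because colimits of presheaves are computed pointwise. Conversely, if \<open>P\<^sub>p\<close> preserves the
  canonical presentation of \<open>E\<^sub>A\<close> as a colimit of representables, then the element of
  \<open>P\<^sub>p(E\<^sub>A)(c)\<close> given by the identity of \<open>E\<^sub>A\<close> comes from some \<open>P\<^sub>p(y(d))(c)\<close>. So \<open>E\<^sub>A\<close> is a
  retract of \<open>y(d)\<close>, and splitting the corresponding idempotent of \<open>d\<close> represents \<open>E\<^sub>A\<close>.\<close>

section \<open>Categories and functors\<close>

text \<open>An extension is given only through an adjunction and a choice of products and pullbacks,
  so there is no formula for the presheaf \<open>fobj P X\<close>. What can be described are the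
  maps from any G into it: those over a fixed A : G \<rightarrow> U correspond, naturally in X, to
  the maps out of E_A. Both implications work from these bijections, with Yoneda turning the
  elements at c into maps out of y(c). Two elements with the same image in \<open>fobj P X\<close>
  lie over the same A, because the projections to U commute with the action of P; this is why the
  summands can be treated one at a time.

  The obstacle is that colimits are given by a universal property, while the argument is about
  elements. To prove that an arbitrary colimit is pointwise, the pointwise quotient must be
  available as a presheaf of small sets with elements in \<open>'v\<close>. Infinity of
  \<open>'v\<close> allows pairs to be coded as elements, and regularity keeps small unions small.
  The same coding makes the category of elements of a presheaf an admissible index category.\<close>

lemma hom_Dom: "f \<in> hom C x y \<Longrightarrow> Dom C f = x"
  and hom_Cod: "f \<in> hom C x y \<Longrightarrow> Cod C f = y"
  and hom_Arr: "f \<in> hom C x y \<Longrightarrow> f \<in> Arr C"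
  and Arr_hom: "f \<in> Arr C \<Longrightarrow> f \<in> hom C (Dom C f) (Cod C f)"
  by (auto simp: hom_def)

context category
begin

lemma hom_Obj: "f \<in> hom C x y \<Longrightarrow> x \<in> Obj C \<and> y \<in> Obj C"
  using Dom_Obj Cod_Obj by (auto simp: hom_def)

lemma isomorphic_trans:
  assumes "isomorphic C x y" "isomorphic C y z"
  shows "isomorphic C x z"
proof -
  obtain f g where f: "f \<in> hom C x y" and g: "g \<in> hom C y x"
    and fg: "Comp C g f = Ide C x" "Comp C f g = Ide C y"
    using assms(1) by (auto simp: isomorphic_def)
  obtain h k where h: "h \<in> hom C y z" and k: "k \<in> hom C z y"
    and hk: "Comp C k h = Ide C y" "Comp C h k = Ide C z"
    using assms(2) by (auto simp: isomorphic_def)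
  have "Comp C (Comp C g k) (Comp C h f) = Ide C x"
    using Comp_assoc[OF Comp_hom[OF f h] k g] Comp_assoc[OF f h k] f fg hk Comp_Ide_left[OF f] by simp
  moreover have "Comp C (Comp C h f) (Comp C g k) = Ide C z"
    using Comp_assoc[OF Comp_hom[OF k g] f h] Comp_assoc[OF k g f] k fg hk Comp_Ide_left[OF k] by simp
  ultimately show ?thesis
    unfolding isomorphic_def using Comp_hom[OF f h] Comp_hom[OF k g] by blast
qed

text \<open>This bridges two choices: \<open>representable\<close> speaks of some pullback of A and
  p, whereas the adjunction speaks of the pullback chosen by the functor \<open>L\<close>.\<close>

lemma pullback_unique:
  assumes P: "is_pullback C f g w p q" and P': "is_pullback C f g w' p' q'"
  shows "isomorphic C w w'"
proof -
  let ?x = "Dom C f" let ?y = "Dom C g"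
  have w: "w \<in> Obj C" "p \<in> hom C w ?x" "q \<in> hom C w ?y" "Comp C f p = Comp C g q"
    using P by (auto simp: is_pullback_def)
  have w': "w' \<in> Obj C" "p' \<in> hom C w' ?x" "q' \<in> hom C w' ?y" "Comp C f p' = Comp C g q'"
    using P' by (auto simp: is_pullback_def)
  have U: "\<exists>!u. u \<in> hom C z w \<and> Comp C p u = a \<and> Comp C q u = b"
    if "z \<in> Obj C" "a \<in> hom C z ?x" "b \<in> hom C z ?y" "Comp C f a = Comp C g b" for z a b
    using P that unfolding is_pullback_def by blast
  have U': "\<exists>!u. u \<in> hom C z w' \<and> Comp C p' u = a \<and> Comp C q' u = b"
    if "z \<in> Obj C" "a \<in> hom C z ?x" "b \<in> hom C z ?y" "Comp C f a = Comp C g b" for z a b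
    using P' that unfolding is_pullback_def by blast
  obtain u where u: "u \<in> hom C w' w" "Comp C p u = p'" "Comp C q u = q'"
    using U[OF w'] by blast
  obtain v where v: "v \<in> hom C w w'" "Comp C p' v = p" "Comp C q' v = q"
    using U'[OF w] by blast
  have "Comp C p (Comp C u v) = p" "Comp C q (Comp C u v) = q"
    using Comp_assoc[OF v(1) u(1)] u v w by auto
  then have "Comp C u v = Ide C w"
    using Comp_hom[OF v(1) u(1)] Ide_hom[OF w(1)]
      Comp_Ide_right[OF w(2)] Comp_Ide_right[OF w(3)] U[OF w] by blast
  moreover have "Comp C p' (Comp C v u) = p'" "Comp C q' (Comp C v u) = q'"
    using Comp_assoc[OF u(1) v(1)] u v w' by auto
  then have "Comp C v u = Ide C w'"
    using Comp_hom[OF u(1) v(1)] Ide_hom[OF w'(1)]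
      Comp_Ide_right[OF w'(2)] Comp_Ide_right[OF w'(3)] U'[OF w'] by blast
  ultimately show ?thesis
    using u v by (auto simp: isomorphic_def)
qed

lemma category_opposite: "category (opposite C)"
proof
  fix f g h w x y z
  assume "f \<in> hom (opposite C) w x" "g \<in> hom (opposite C) x y" "h \<in> hom (opposite C) y z"
  then have "f \<in> hom C x w" "g \<in> hom C y x" "h \<in> hom C z y"
    by (auto simp: hom_def opposite_def)
  then show "Comp (opposite C) h (Comp (opposite C) g f) = Comp (opposite C) (Comp (opposite C) h g) f"
    by (simp add: opposite_def Comp_assoc)
qed (use Dom_Obj Cod_Obj Ide_hom Comp_hom Comp_Ide_left Comp_Ide_right in
    \<open>auto simp: opposite_def hom_def\<close>)

end

lemma hom_opposite: "hom (opposite C) x y = hom C y x"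
  by (auto simp: opposite_def hom_def)

lemma functor_obj: "is_functor C D F \<Longrightarrow> x \<in> Obj C \<Longrightarrow> fobj F x \<in> Obj D"
  by (auto simp: is_functor_def)

lemma functor_hom:
  "is_functor C D F \<Longrightarrow> f \<in> hom C x y \<Longrightarrow> farr F f \<in> hom D (fobj F x) (fobj F y)"
  by (auto simp: is_functor_def)

lemma functor_Ide: "is_functor C D F \<Longrightarrow> x \<in> Obj C \<Longrightarrow> farr F (Ide C x) = Ide D (fobj F x)"
  by (auto simp: is_functor_def)

lemma functor_Comp:
  "is_functor C D F \<Longrightarrow> f \<in> hom C x y \<Longrightarrow> g \<in> hom C y z \<Longrightarrow>
    farr F (Comp C g f) = Comp D (farr F g) (farr F f)"
  unfolding is_functor_def by blast

lemma fobj_fcomp: "x \<in> Obj C \<Longrightarrow> fobj (fcomp C G F) x = fobj G (fobj F x)"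
  and farr_fcomp: "f \<in> Arr C \<Longrightarrow> farr (fcomp C G F) f = farr G (farr F f)"
  by (auto simp: fcomp_def)

lemma is_functor_fcomp:
  assumes F: "is_functor C D F" and G: "is_functor D E G"
  shows "is_functor C E (fcomp C G F)"
proof -
  interpret C: category C using F by (simp add: is_functor_def)
  have E: "category E" using G by (simp add: is_functor_def)
  show ?thesis
    unfolding is_functor_def
  proof (intro conjI ballI allI)
    show "fobj (fcomp C G F) \<in> Obj C \<rightarrow>\<^sub>E Obj E"
      using F G by (auto simp: fcomp_def functor_obj)
    have "farr G (farr F f) \<in> Arr E" if "f \<in> Arr C" for f
      using functor_hom[OF G functor_hom[OF F Arr_hom[OF that]]] by (rule hom_Arr)
    then show "farr (fcomp C G F) \<in> Arr C \<rightarrow>\<^sub>E Arr E"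
      by (auto simp: fcomp_def)
    fix x y f assume f: "f \<in> hom C x y"
    then show "farr (fcomp C G F) f \<in> hom E (fobj (fcomp C G F) x) (fobj (fcomp C G F) y)"
      using C.hom_Obj[OF f] functor_hom[OF G functor_hom[OF F f]]
      by (simp add: fobj_fcomp farr_fcomp hom_Arr)
  next
    fix x assume "x \<in> Obj C"
    then show "farr (fcomp C G F) (Ide C x) = Ide E (fobj (fcomp C G F) x)"
      using F G by (simp add: fobj_fcomp farr_fcomp functor_Ide functor_obj hom_Arr[OF C.Ide_hom])
  next
    fix x y z f g assume fg: "f \<in> hom C x y" "g \<in> hom C y z"
    show "farr (fcomp C G F) (Comp C g f) = Comp E (farr (fcomp C G F) g) (farr (fcomp C G F) f)"
      using fg hom_Arr[OF C.Comp_hom[OF fg]] functor_Comp[OF F fg]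
        functor_Comp[OF G functor_hom[OF F fg(1)] functor_hom[OF F fg(2)]]
      by (simp add: farr_fcomp hom_Arr)
  qed (use E C.category_axioms in auto)
qed

section \<open>The extension as a polynomial functor\<close>

lemma slice_hom_iff:
  "h \<in> hom (slice C x) a b \<longleftrightarrow> sl_dom h = a \<and> sl_cod h = b \<and> a \<in> Arr C \<and> Cod C a = x \<and>
    b \<in> Arr C \<and> Cod C b = x \<and> sl_map h \<in> hom C (Dom C a) (Dom C b) \<and> Comp C b (sl_map h) = a"
  by (auto simp: hom_def slice_def)

lemma slice_Obj_iff: "a \<in> Obj (slice C x) \<longleftrightarrow> a \<in> Arr C \<and> Cod C a = x"
  by (simp add: slice_def)

lemma slice_Comp: "Comp (slice C x) k h =
    \<lparr>sl_dom = sl_dom h, sl_cod = sl_cod k, sl_map = Comp C (sl_map k) (sl_map h)\<rparr>"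
  by (simp add: slice_def)

text \<open>That the slice is a category is a hypothesis because it comes for free where the lemma
  is applied, as part of the functoriality of \<open>R\<close>.\<close>

lemma is_functor_slice_forget:
  assumes "category C" and "category (slice C x)"
  shows "is_functor (slice C x) C (slice_forget C x)"
proof -
  interpret category C by fact
  interpret S: category "slice C x" by fact
  have C: "Comp (slice C x) g f \<in> hom (slice C x) a c"
    if "f \<in> hom (slice C x) a b" "g \<in> hom (slice C x) b c" for f g a b c
    using that by (rule S.Comp_hom)
  show ?thesis
    unfolding is_functor_def
  proof (intro conjI ballI allI)
    fix a assume a: "a \<in> Obj (slice C x)"
    show "farr (slice_forget C x) (Ide (slice C x) a) = Ide C (fobj (slice_forget C x) a)"
      using a hom_Arr[OF S.Ide_hom[OF a]] by (simp add: slice_forget_def slice_def)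
  next
    fix a b c f g assume fg: "f \<in> hom (slice C x) a b" "g \<in> hom (slice C x) b c"
    show "farr (slice_forget C x) (Comp (slice C x) g f) =
       Comp C (farr (slice_forget C x) g) (farr (slice_forget C x) f)"
      using fg hom_Arr[OF C[OF fg]] by (simp add: slice_forget_def hom_Arr) (simp add: slice_Comp)
  next
    fix a b f assume f: "f \<in> hom (slice C x) a b"
    show "farr (slice_forget C x) f \<in> hom C (fobj (slice_forget C x) a) (fobj (slice_forget C x) b)"
      using hom_Arr[OF f] S.hom_Obj[OF f] f by (simp add: slice_forget_def slice_hom_iff)
  next
    show "farr (slice_forget C x) \<in> Arr (slice C x) \<rightarrow>\<^sub>E Arr C"
      using slice_hom_iff[of _ C x] Arr_hom[of _ "slice C x"]
      by (fastforce simp: slice_forget_def dest: hom_Arr)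
    show "fobj (slice_forget C x) \<in> Obj (slice C x) \<rightarrow>\<^sub>E Obj C"
      by (auto simp: slice_forget_def slice_Obj_iff Dom_Obj)
  qed (use assms in auto)
qed

lemma is_functor_extension:
  assumes "is_extension C p P"
  shows "is_functor C C P"
proof -
  obtain F L R where F: "is_functor C (slice C (Dom C p)) F"
    and R: "is_functor (slice C (Dom C p)) (slice C (Cod C p)) R"
    and P: "P = fcomp C (slice_forget C (Cod C p)) (fcomp C R F)"
    using assms by (auto simp: is_extension_def is_product_functor_def adjunction_def)
  have "category C" "category (slice C (Cod C p))"
    using F R by (auto simp: is_functor_def)
  from is_functor_fcomp[OF is_functor_fcomp[OF F R] is_functor_slice_forget[OF this]]
  show ?thesis using P by simp
qed

text \<open>A slice map over U from A to \<open>R (F X)\<close> transposes to a slice map over V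
  from \<open>L A\<close> to \<open>F X\<close>. As \<open>F X\<close> is the projection of X
  \<times> V to V, the latter amounts to a plain map E A \<rightarrow> X. The former amounts to an
  arrow t into \<open>fobj P X\<close> with \<open>Comp K (q X) t = A\<close>. The argument takes
  place in an arbitrary category K.\<close>

lemma extension_polynomial:
  fixes K :: "('o, 'a) cat" and p :: 'a and P :: "('o, 'a, 'o, 'a) fctr"
  assumes "is_extension K p P"
  obtains q E \<pi>\<^sub>1 \<pi>\<^sub>2 \<Phi> where
    "\<And>X. X \<in> Obj K \<Longrightarrow> q X \<in> hom K (fobj P X) (Cod K p)"
    "\<And>X Y f. f \<in> hom K X Y \<Longrightarrow> Comp K (q Y) (farr P f) = q X"
    "\<And>G A. A \<in> hom K G (Cod K p) \<Longrightarrow> is_pullback K A p (E A) (\<pi>\<^sub>1 A) (\<pi>\<^sub>2 A)"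
    "\<And>G A X. A \<in> hom K G (Cod K p) \<Longrightarrow> X \<in> Obj K \<Longrightarrow>
      bij_betw (\<Phi> A X) (hom K (E A) X) {t \<in> hom K G (fobj P X). Comp K (q X) t = A}"
    "\<And>G A X Y f h. A \<in> hom K G (Cod K p) \<Longrightarrow> f \<in> hom K X Y \<Longrightarrow> h \<in> hom K (E A) X \<Longrightarrow>
      \<Phi> A Y (Comp K f h) = Comp K (farr P f) (\<Phi> A X h)"
proof -
  let ?V = "Dom K p" let ?U = "Cod K p"
  obtain F L R where F: "is_product_functor K ?V F" and L: "is_pullback_functor K p L"
    and adj: "adjunction (slice K ?U) (slice K ?V) L R"
    and P: "P = fcomp K (slice_forget K ?U) (fcomp K R F)"
    using assms by (auto simp: is_extension_def)
  have F': "is_functor K (slice K ?V) F" using F by (simp add: is_product_functor_def)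
  have L': "is_functor (slice K ?U) (slice K ?V) L" using L by (simp add: is_pullback_functor_def)
  have R': "is_functor (slice K ?V) (slice K ?U) R" using adj by (simp add: adjunction_def)
  interpret K: category K using F' by (simp add: is_functor_def)
  interpret SU: category "slice K ?U" using L' by (simp add: is_functor_def)
  interpret SV: category "slice K ?V" using L' by (simp add: is_functor_def)
  obtain \<pi> where \<pi>: "\<And>X. X \<in> Obj K \<Longrightarrow> is_binary_product K X ?V (Dom K (fobj F X)) (\<pi> X) (fobj F X)"
    and \<pi>_nat: "\<And>X Y f. f \<in> hom K X Y \<Longrightarrow> Comp K (\<pi> Y) (sl_map (farr F f)) = Comp K f (\<pi> X)"
    using F unfolding is_product_functor_def by blast
  obtain \<rho> where \<rho>: "\<And>A. A \<in> Obj (slice K ?U) \<Longrightarrow> is_pullback K A p (Dom K (fobj L A)) (\<rho> A) (fobj L A)"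
    using L unfolding is_pullback_functor_def by blast
  obtain \<phi> where \<phi>: "\<And>A B. A \<in> Obj (slice K ?U) \<Longrightarrow> B \<in> Obj (slice K ?V) \<Longrightarrow>
      bij_betw (\<phi> A B) (hom (slice K ?V) (fobj L A) B) (hom (slice K ?U) A (fobj R B))"
    and \<phi>_nat: "\<And>A A' B B' h k f. h \<in> hom (slice K ?U) A' A \<Longrightarrow> k \<in> hom (slice K ?V) B B' \<Longrightarrow>
      f \<in> hom (slice K ?V) (fobj L A) B \<Longrightarrow>
      \<phi> A' B' (Comp (slice K ?V) k (Comp (slice K ?V) f (farr L h))) =
        Comp (slice K ?U) (farr R k) (Comp (slice K ?U) (\<phi> A B f) h)"
    using adj unfolding adjunction_def by blast
  \<comment> \<open>The object \<open>R (F X)\<close> of the slice is itself an arrow into U. Its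
    domain is \<open>fobj P X\<close>, so it is the projection of the polynomial functor to its
    base.\<close>
  define q where "q X = fobj R (fobj F X)" for X
  define E where "E A = Dom K (fobj L A)" for A
  define proj where "proj X m = Comp K (\<pi> X) (sl_map m)" for X and m :: "'a slice_arr"
  define S where "S A X = hom (slice K ?V) (fobj L A) (fobj F X)" for A X
  \<comment> \<open>Read from right to left: complete a map E A \<rightarrow> X to a slice map into
    X \<times> V, transpose it, and forget the slice structure.\<close>
  define \<Phi> where "\<Phi> A X = sl_map \<circ> \<phi> A (fobj F X) \<circ> inv_into (S A X) (proj X)" for A X
  have FX: "fobj F X \<in> Obj (slice K ?V)" if "X \<in> Obj K" for X
    using functor_obj[OF F' that] .
  have qX: "q X \<in> Obj (slice K ?U)" if "X \<in> Obj K" for X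
    unfolding q_def using functor_obj[OF R' FX[OF that]] .
  have PX: "fobj P X = Dom K (q X)" if "X \<in> Obj K" for X
    using that qX[OF that] by (simp add: P fobj_fcomp slice_forget_def q_def)
  have Pf: "farr P f = sl_map (farr R (farr F f))" if "f \<in> hom K X Y" for f X Y
    using hom_Arr[OF that] hom_Arr[OF functor_hom[OF R' functor_hom[OF F' that]]]
    by (simp add: P farr_fcomp slice_forget_def)
  have RFf: "farr R (farr F f) \<in> hom (slice K ?U) (q X) (q Y)" if "f \<in> hom K X Y" for f X Y
    unfolding q_def using functor_hom[OF R' functor_hom[OF F' that]] .
  have A_Obj: "A \<in> Obj (slice K ?U)" if "A \<in> hom K G ?U" for G A
    using that by (simp add: slice_Obj_iff hom_def)
  have LA: "fobj L A \<in> hom K (E A) ?V" if "A \<in> hom K G ?U" for G A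
    using functor_obj[OF L' A_Obj[OF that]] by (simp add: slice_Obj_iff hom_def E_def)
  \<comment> \<open>The second component of a slice map from \<open>fobj L A\<close> to the
    projection \<open>fobj F X\<close> is forced to be \<open>fobj L A\<close>, which leaves exactly
    the first component free.\<close>
  have proj: "bij_betw (proj X) (S A X) (hom K (E A) X)"
    if A: "A \<in> hom K G ?U" and X: "X \<in> Obj K" for A G X
  proof -
    have LA: "fobj L A \<in> hom K (E A) ?V" using LA[OF A] .
    have FX': "fobj F X \<in> hom K (Dom K (fobj F X)) ?V"
      using FX[OF X] by (simp add: slice_Obj_iff hom_def)
    have \<pi>X: "\<pi> X \<in> hom K (Dom K (fobj F X)) X" using \<pi>[OF X] by (simp add: is_binary_product_def)
    have S_iff: "m \<in> S A X \<longleftrightarrow> sl_dom m = fobj L A \<and> sl_cod m = fobj F X \<and>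
        sl_map m \<in> hom K (E A) (Dom K (fobj F X)) \<and> Comp K (fobj F X) (sl_map m) = fobj L A" for m
      using LA FX' by (auto simp: S_def slice_hom_iff E_def hom_Arr hom_Cod)
    have ex: "\<exists>!u. u \<in> hom K (E A) (Dom K (fobj F X)) \<and> Comp K (\<pi> X) u = h \<and> Comp K (fobj F X) u = fobj L A"
      if "h \<in> hom K (E A) X" for h
      using \<pi>[OF X] that LA K.hom_Obj[OF that] unfolding is_binary_product_def by blast
    show ?thesis
    proof (rule bij_betwI')
      fix m n assume mn: "m \<in> S A X" "n \<in> S A X"
      show "(proj X m = proj X n) = (m = n)"
      proof
        assume eq: "proj X m = proj X n"
        have "proj X m \<in> hom K (E A) X"
          using mn K.Comp_hom[OF _ \<pi>X] by (simp add: proj_def S_iff)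
        from ex[OF this] have "sl_map m = sl_map n"
          using mn eq unfolding S_iff proj_def by metis
        then show "m = n" using mn by (simp add: S_iff)
      qed simp
    next
      fix m assume "m \<in> S A X"
      then show "proj X m \<in> hom K (E A) X"
        using K.Comp_hom[OF _ \<pi>X] by (simp add: proj_def S_iff)
    next
      fix h assume "h \<in> hom K (E A) X"
      from ex1_implies_ex[OF ex[OF this]] obtain u where "u \<in> hom K (E A) (Dom K (fobj F X))" "Comp K (\<pi> X) u = h"
        "Comp K (fobj F X) u = fobj L A" by blast
      then show "\<exists>m \<in> S A X. h = proj X m"
        by (intro bexI[of _ "\<lparr>sl_dom = fobj L A, sl_cod = fobj F X, sl_map = u\<rparr>"])
          (auto simp: proj_def S_iff)
    qed
  qed
  have \<phi>': "bij_betw (\<phi> A (fobj F X)) (S A X) (hom (slice K ?U) A (q X))"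
    if "A \<in> hom K G ?U" "X \<in> Obj K" for A G X
    unfolding S_def q_def using \<phi>[OF A_Obj[OF that(1)] FX[OF that(2)]] .
  have slmap: "bij_betw sl_map (hom (slice K ?U) A (q X)) {t \<in> hom K G (fobj P X). Comp K (q X) t = A}"
    if A: "A \<in> hom K G ?U" and X: "X \<in> Obj K" for A G X
  proof (rule bij_betwI')
    fix t assume t: "t \<in> {t \<in> hom K G (fobj P X). Comp K (q X) t = A}"
    have "\<lparr>sl_dom = A, sl_cod = q X, sl_map = t\<rparr> \<in> hom (slice K ?U) A (q X)"
      using t PX[OF X] qX[OF X] A by (simp add: slice_hom_iff slice_Obj_iff hom_Dom hom_Cod hom_Arr)
    then show "\<exists>m \<in> hom (slice K ?U) A (q X). t = sl_map m"
      by (rule bexI[rotated]) simp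
  qed (use A qX[OF X] PX[OF X] in \<open>auto simp: slice_hom_iff hom_Dom\<close>)
  show ?thesis
  proof (rule that[of q E \<rho> "fobj L" \<Phi>])
    fix X assume X: "X \<in> Obj K"
    show "q X \<in> hom K (fobj P X) ?U"
      using qX[OF X] PX[OF X] by (simp add: slice_Obj_iff hom_def)
  next
    fix f X Y assume "f \<in> hom K X Y"
    then show "Comp K (q Y) (farr P f) = q X"
      using RFf Pf by (simp add: slice_hom_iff)
  next
    fix A G assume "A \<in> hom K G ?U"
    then show "is_pullback K A p (E A) (\<rho> A) (fobj L A)"
      unfolding E_def using \<rho>[OF A_Obj] by blast
  next
    fix A G X assume A: "A \<in> hom K G ?U" and X: "X \<in> Obj K"
    show "bij_betw (\<Phi> A X) (hom K (E A) X) {t \<in> hom K G (fobj P X). Comp K (q X) t = A}"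
      unfolding \<Phi>_def using bij_betw_trans[OF bij_betw_inv_into[OF proj[OF A X]]
          bij_betw_trans[OF \<phi>'[OF A X] slmap[OF A X]]] by (simp add: comp_assoc)
  next
    fix A G X Y f h assume A: "A \<in> hom K G ?U" and f: "f \<in> hom K X Y" and h: "h \<in> hom K (E A) X"
    have XY: "X \<in> Obj K" "Y \<in> Obj K" using K.hom_Obj[OF f] by auto
    define m where "m = inv_into (S A X) (proj X) h"
    have m: "m \<in> S A X" "proj X m = h"
      using proj[OF A XY(1)] h unfolding m_def
      by (auto simp: bij_betw_def inv_into_into f_inv_into_f)
    have \<pi>XY: "\<pi> X \<in> hom K (Dom K (fobj F X)) X" "\<pi> Y \<in> hom K (Dom K (fobj F Y)) Y"
      using \<pi> XY by (auto simp: is_binary_product_def)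
    have Ff: "farr F f \<in> hom (slice K ?V) (fobj F X) (fobj F Y)" using functor_hom[OF F' f] .
    define n where "n = Comp (slice K ?V) (farr F f) m"
    have n: "n \<in> S A Y" using m SV.Comp_hom[OF _ Ff] by (auto simp: n_def S_def)
    have sm: "sl_map m \<in> hom K (E A) (Dom K (fobj F X))"
      "sl_map (farr F f) \<in> hom K (Dom K (fobj F X)) (Dom K (fobj F Y))"
      using m Ff by (auto simp: S_def slice_hom_iff E_def)
    have "proj Y n = Comp K f h"
      using \<pi>_nat[OF f] K.Comp_assoc[OF sm(1) sm(2) \<pi>XY(2)] K.Comp_assoc[OF sm(1) \<pi>XY(1) f] m
      by (simp add: n_def proj_def slice_Comp)
    then have inv_n: "inv_into (S A Y) (proj Y) (Comp K f h) = n"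
      using proj[OF A XY(2)] n by (metis bij_betw_inv_into_left)
    \<comment> \<open>Naturality of the transposition is given in both variables at once; inserting
      the identity of A isolates the variation in X.\<close>
    have idA: "Ide (slice K ?U) A \<in> hom (slice K ?U) A A" using SU.Ide_hom[OF A_Obj[OF A]] .
    have mL: "Comp (slice K ?V) m (farr L (Ide (slice K ?U) A)) = m"
      using functor_Ide[OF L' A_Obj[OF A]] SV.Comp_Ide_right m(1) by (simp add: S_def)
    have "\<phi> A (fobj F X) m \<in> hom (slice K ?U) A (q X)"
      using \<phi>'[OF A XY(1)] m(1) by (rule bij_betwE[THEN bspec])
    from SU.Comp_Ide_right[OF this]
    have "\<phi> A (fobj F Y) n = Comp (slice K ?U) (farr R (farr F f)) (\<phi> A (fobj F X) m)"
      using \<phi>_nat[OF idA Ff m(1)[unfolded S_def]] mL by (simp add: n_def)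
    then show "\<Phi> A Y (Comp K f h) = Comp K (farr P f) (\<Phi> A X h)"
      using Pf[OF f] by (simp add: \<Phi>_def inv_n flip: m_def) (simp add: slice_Comp)
  qed
qed

section \<open>Small sets\<close>

lemma small_image: "small A \<Longrightarrow> small (f ` A)"
  for A :: "'v set" and f :: "'v \<Rightarrow> 'v"
  unfolding small_def by (rule ordLeq_ordLess_trans[OF card_of_image])

lemma small_subset: "small A \<Longrightarrow> B \<subseteq> A \<Longrightarrow> small B"
  unfolding small_def by (rule ordLeq_ordLess_trans[OF card_of_mono1])

text \<open>Regularity of the cardinal enters here: fewer than |UNIV| sets, each of cardinality less
  than |UNIV|, have a union of cardinality less than |UNIV|.\<close>

lemma small_UNION:
  fixes A :: "'v \<Rightarrow> 'v set"
  assumes "infinite (UNIV :: 'v set)" "regularCard |UNIV :: 'v set|"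
    and "small I" "\<And>i. i \<in> I \<Longrightarrow> small (A i)"
  shows "small (\<Union>i \<in> I. A i)"
proof -
  have "Cinfinite |UNIV :: 'v set|"
    using assms(1) by (simp add: cinfinite_def Field_card_of card_of_card_order_on)
  from card_of_UNION_ordLess_infinite_Field_regularCard[OF assms(2) this, of I A]
  show ?thesis using assms(3,4) by (simp add: small_def)
qed

text \<open>Pairs of elements are not elements of \<open>'v\<close>, and \<open>small\<close>
  compares a set with its own type. So smallness of a dependent sum is stated for its image under a
  map back into \<open>'v\<close>.\<close>

lemma small_Sigma_image:
  fixes A :: "'v \<Rightarrow> 'v set" and h :: "'v \<times> 'v \<Rightarrow> 'v"
  assumes "infinite (UNIV :: 'v set)" "regularCard |UNIV :: 'v set|"
    and "small I" "\<And>i. i \<in> I \<Longrightarrow> small (A i)"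
  shows "small (h ` Sigma I A)"
proof -
  have "small (\<Union>i \<in> I. (\<lambda>a. h (i, a)) ` A i)"
    by (rule small_UNION[OF assms(1-3)]) (intro small_image assms(4))
  also have "(\<Union>i \<in> I. (\<lambda>a. h (i, a)) ` A i) = h ` Sigma I A"
    by auto
  finally show ?thesis .
qed

text \<open>Any injective coding will do. It serves to represent both the objects and arrows of a
  category of elements and the elements of a disjoint union inside \<open>'v\<close>.\<close>

definition pair :: "'v \<times> 'v \<Rightarrow> 'v" where
  "pair = (SOME h. inj h)"

lemma inj_pair:
  assumes "infinite (UNIV :: 'v set)"
  shows "inj (pair :: 'v \<times> 'v \<Rightarrow> 'v)"
proof -
  have "|UNIV :: ('v \<times> 'v) set| \<le>o |UNIV :: 'v set|"
    using card_of_Times_same_infinite[OF assms] by (simp add: ordIso_imp_ordLeq)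
  then have "\<exists>h :: 'v \<times> 'v \<Rightarrow> 'v. inj h"
    by (auto simp flip: card_of_ordLeq)
  then show ?thesis unfolding pair_def by (rule someI_ex)
qed

section \<open>Presheaves\<close>

lemma Set_hom_iff: "f \<in> hom Set_cat A B \<longleftrightarrow>
    small A \<and> small B \<and> sm_dom f = A \<and> sm_cod f = B \<and> sm_fun f \<in> A \<rightarrow>\<^sub>E B"
  by (auto simp: hom_def Set_cat_def)

lemma Set_Comp: "Comp Set_cat g f = \<lparr>sm_dom = sm_dom f, sm_cod = sm_cod g,
    sm_fun = compose (sm_dom f) (sm_fun g) (sm_fun f)\<rparr>"
  by (simp add: Set_cat_def)

lemma Set_Ide: "Ide Set_cat A = \<lparr>sm_dom = A, sm_cod = A, sm_fun = (\<lambda>x \<in> A. x)\<rparr>"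
  by (simp add: Set_cat_def)

lemma set_map_eqI:
  fixes f g :: "'v set_map"
  assumes "f \<in> hom Set_cat A B" "g \<in> hom Set_cat A B" "\<And>x. x \<in> A \<Longrightarrow> sm_fun f x = sm_fun g x"
  shows "f = g"
proof (rule set_map.equality)
  show "sm_fun f = sm_fun g"
    using assms by (intro extensionalityI[of _ A]) (auto simp: Set_hom_iff PiE_def)
qed (use assms(1,2) in \<open>auto simp: Set_hom_iff\<close>)

lemma category_Set_cat: "category Set_cat"
proof
  fix f g :: "'v set_map" and x y z assume fg: "f \<in> hom Set_cat x y" "g \<in> hom Set_cat y z"
  then show "Comp Set_cat g f \<in> hom Set_cat x z"
    by (auto simp: Set_hom_iff Set_Comp compose_def)
next
  fix f g h :: "'v set_map" and w x y z
  assume "f \<in> hom Set_cat w x" "g \<in> hom Set_cat x y" "h \<in> hom Set_cat y z"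
  then show "Comp Set_cat h (Comp Set_cat g f) = Comp Set_cat (Comp Set_cat h g) f"
    using compose_assoc[of "sm_fun f" w x] by (simp add: Set_Comp Set_hom_iff PiE_def)
next
  fix f :: "'v set_map" and x y assume f: "f \<in> hom Set_cat x y"
  show "Comp Set_cat (Ide Set_cat y) f = f" "Comp Set_cat f (Ide Set_cat x) = f"
    by (rule set_map_eqI[of _ x y];
        use f in \<open>auto simp: Set_hom_iff Set_Comp Set_Ide compose_def\<close>)+
next
  fix x :: "'v set" assume "x \<in> Obj Set_cat"
  then have "small x" by (simp add: Set_cat_def)
  then show "Ide Set_cat x \<in> hom Set_cat x x"
    by (auto simp: Set_hom_iff Set_Ide)
qed (auto simp: Set_cat_def)

section \<open>Presheaves as families of sets with a right action, and their maps\<close>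

definition res :: "'v presheaf \<Rightarrow> 'v \<Rightarrow> 'v \<Rightarrow> 'v" where
  "res X f = sm_fun (farr X f)"

definition act :: "'v presheaf_map \<Rightarrow> 'v \<Rightarrow> 'v \<Rightarrow> 'v" where
  "act t c = sm_fun (nt_at t c)"

text \<open>The restricted abstractions supply the extensionality that \<open>is_functor\<close> and
  \<open>Set_cat\<close> demand, so the data \<open>S\<close> and \<open>r\<close> may behave
  arbitrarily outside their intended domains.\<close>

definition mk_psh :: "('v, 'v) cat \<Rightarrow> ('v \<Rightarrow> 'v set) \<Rightarrow> ('v \<Rightarrow> 'v \<Rightarrow> 'v) \<Rightarrow> 'v presheaf" where
  "mk_psh C S r = \<lparr>fobj = (\<lambda>c \<in> Obj C. S c),
    farr = (\<lambda>f \<in> Arr C. \<lparr>sm_dom = S (Cod C f), sm_cod = S (Dom C f), sm_fun = (\<lambda>x \<in> S (Cod C f). r f x)\<rparr>)\<rparr>"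

definition mk_map :: "('v, 'v) cat \<Rightarrow> 'v presheaf \<Rightarrow> 'v presheaf \<Rightarrow> ('v \<Rightarrow> 'v \<Rightarrow> 'v) \<Rightarrow> 'v presheaf_map" where
  "mk_map C X Y h = \<lparr>nt_dom = X, nt_cod = Y,
    nt_at = (\<lambda>c \<in> Obj C. \<lparr>sm_dom = fobj X c, sm_cod = fobj Y c, sm_fun = (\<lambda>x \<in> fobj X c. h c x)\<rparr>)\<rparr>"

lemma PSh_hom_iff: "t \<in> hom (PSh C) X Y \<longleftrightarrow>
    is_nat_trans (opposite C) Set_cat t \<and> nt_dom t = X \<and> nt_cod t = Y"
  by (auto simp: hom_def PSh_def functor_cat_def)

lemma PSh_Obj_iff: "X \<in> Obj (PSh C) \<longleftrightarrow> is_functor (opposite C) Set_cat X"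
  by (simp add: PSh_def functor_cat_def)

lemma opposite_Obj: "Obj (opposite C) = Obj C" by (simp add: opposite_def)

text \<open>The pointwise calculus of presheaves rests on the category axioms alone; sharing one
  type between objects, arrows and elements is what \<open>PSh\<close> prescribes. Size enters with
  \<open>small_cat\<close>.\<close>

locale single_typed_cat = category C for C :: "('v, 'v) cat"
begin

lemma res_set_map:
  assumes "X \<in> Obj (PSh C)" "f \<in> hom C d c"
  shows "farr X f \<in> hom Set_cat (fobj X c) (fobj X d)"
  using assms functor_hom[of "opposite C" Set_cat X] by (simp add: PSh_Obj_iff hom_opposite)

lemma small_fobj: "X \<in> Obj (PSh C) \<Longrightarrow> c \<in> Obj C \<Longrightarrow> small (fobj X c)"
  using res_set_map[OF _ Ide_hom] by (auto simp: Set_hom_iff)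

lemma res_closed:
  assumes "X \<in> Obj (PSh C)" "f \<in> hom C d c" "x \<in> fobj X c"
  shows "res X f x \<in> fobj X d"
  using res_set_map[OF assms(1,2)] assms(3) by (auto simp: Set_hom_iff res_def)

lemma res_Ide:
  assumes "X \<in> Obj (PSh C)" "x \<in> fobj X c" "c \<in> Obj C"
  shows "res X (Ide C c) x = x"
proof -
  have "farr X (Ide C c) = Ide Set_cat (fobj X c)"
    using assms functor_Ide[of "opposite C" Set_cat X c] by (simp add: PSh_Obj_iff opposite_def)
  then show ?thesis using assms by (simp add: res_def Set_Ide)
qed

lemma res_Comp:
  assumes "X \<in> Obj (PSh C)" "f \<in> hom C d c" "g \<in> hom C e d" "x \<in> fobj X c"
  shows "res X (Comp C f g) x = res X g (res X f x)"
proof -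
  have "farr X (Comp C f g) = Comp Set_cat (farr X g) (farr X f)"
    using assms functor_Comp[of "opposite C" Set_cat X f c d g e]
    by (simp add: PSh_Obj_iff hom_opposite) (simp add: opposite_def)
  then show ?thesis using assms res_set_map[OF assms(1,2)]
    by (simp add: res_def Set_Comp Set_hom_iff compose_def)
qed

lemma mk_psh_Obj:
  assumes "\<And>c. c \<in> Obj C \<Longrightarrow> small (S c)"
    and r: "\<And>c d f x. f \<in> hom C d c \<Longrightarrow> x \<in> S c \<Longrightarrow> r f x \<in> S d"
    and "\<And>c x. c \<in> Obj C \<Longrightarrow> x \<in> S c \<Longrightarrow> r (Ide C c) x = x"
    and "\<And>c d e f g x. f \<in> hom C d c \<Longrightarrow> g \<in> hom C e d \<Longrightarrow> x \<in> S c \<Longrightarrow>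
      r (Comp C f g) x = r g (r f x)"
  shows "mk_psh C S r \<in> Obj (PSh C)"
  unfolding PSh_Obj_iff is_functor_def
proof (intro conjI ballI allI category_opposite category_Set_cat)
  let ?X = "mk_psh C S r"
  show "fobj ?X \<in> Obj (opposite C) \<rightarrow>\<^sub>E Obj Set_cat"
    using assms(1) by (auto simp: mk_psh_def opposite_def Set_cat_def)
  have *: "farr ?X f \<in> hom Set_cat (S c) (S d)" if f: "f \<in> hom C d c" for f c d
    using r[OF f] assms(1) f hom_Obj[OF f]
    by (auto simp: mk_psh_def Set_hom_iff hom_Arr hom_Dom hom_Cod)
  then show "farr ?X \<in> Arr (opposite C) \<rightarrow>\<^sub>E Arr Set_cat"
    using hom_Arr[OF *[OF Arr_hom]] by (auto simp: mk_psh_def opposite_def)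
  fix x y f assume "f \<in> hom (opposite C) x y"
  then have f: "f \<in> hom C y x" by (simp add: hom_opposite)
  then show "farr ?X f \<in> hom Set_cat (fobj ?X x) (fobj ?X y)"
    using *[OF f] hom_Obj[OF f] by (simp add: mk_psh_def)
next
  fix c assume "c \<in> Obj (opposite C)"
  then have c: "c \<in> Obj C" by (simp add: opposite_def)
  then show "farr (mk_psh C S r) (Ide (opposite C) c) = Ide Set_cat (fobj (mk_psh C S r) c)"
    using Ide_hom[OF c] assms(3)[OF c]
    by (auto simp: mk_psh_def Set_Ide opposite_def hom_Arr hom_Dom hom_Cod)
next
  fix c d e f g assume "f \<in> hom (opposite C) c d" "g \<in> hom (opposite C) d e"
  then have f: "f \<in> hom C d c" and g: "g \<in> hom C e d" by (auto simp: hom_opposite)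
  have "r (Comp C f g) x = r g (r f x)" "r f x \<in> S d" if "x \<in> S c" for x
    using assms(4)[OF f g that] r[OF f that] by auto
  then show "farr (mk_psh C S r) (Comp (opposite C) g f) =
      Comp Set_cat (farr (mk_psh C S r) g) (farr (mk_psh C S r) f)"
    using f g Comp_hom[OF g f]
    by (auto simp: mk_psh_def Set_Comp opposite_def hom_Arr hom_Dom hom_Cod compose_def)
qed

lemma fobj_mk_psh: "c \<in> Obj C \<Longrightarrow> fobj (mk_psh C S r) c = S c"
  by (simp add: mk_psh_def)

lemma res_mk_psh: "f \<in> hom C d c \<Longrightarrow> x \<in> S c \<Longrightarrow> res (mk_psh C S r) f x = r f x"
  by (simp add: mk_psh_def res_def hom_Arr hom_Cod)

lemma act_set_map:
  assumes "t \<in> hom (PSh C) X Y" "c \<in> Obj C"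
  shows "nt_at t c \<in> hom Set_cat (fobj X c) (fobj Y c)"
  using assms by (auto simp: PSh_hom_iff is_nat_trans_def opposite_Obj)

lemma act_closed: "t \<in> hom (PSh C) X Y \<Longrightarrow> c \<in> Obj C \<Longrightarrow> x \<in> fobj X c \<Longrightarrow> act t c x \<in> fobj Y c"
  using act_set_map[of t X Y c] by (auto simp: act_def Set_hom_iff)

lemma PSh_hom_Obj: "t \<in> hom (PSh C) X Y \<Longrightarrow> X \<in> Obj (PSh C) \<and> Y \<in> Obj (PSh C)"
  by (auto simp: PSh_hom_iff PSh_Obj_iff is_nat_trans_def)

lemma act_natural:
  assumes t: "t \<in> hom (PSh C) X Y" and f: "f \<in> hom C d c" and x: "x \<in> fobj X c"
  shows "act t d (res X f x) = res Y f (act t c x)"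
proof -
  have "Comp Set_cat (farr Y f) (nt_at t c) = Comp Set_cat (nt_at t d) (farr X f)"
    using t f unfolding PSh_hom_iff is_nat_trans_def hom_opposite by blast
  then have "compose (fobj X c) (sm_fun (farr Y f)) (sm_fun (nt_at t c)) x =
      compose (fobj X c) (sm_fun (nt_at t d)) (sm_fun (farr X f)) x"
    using act_set_map[OF t] hom_Obj[OF f] res_set_map[OF _ f] PSh_hom_Obj[OF t]
    by (simp add: Set_Comp Set_hom_iff)
  then show ?thesis using x by (simp add: compose_def act_def res_def)
qed

lemma PSh_map_eqI:
  assumes t: "t \<in> hom (PSh C) X Y" and s: "s \<in> hom (PSh C) X Y"
    and eq: "\<And>c x. c \<in> Obj C \<Longrightarrow> x \<in> fobj X c \<Longrightarrow> act t c x = act s c x"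
  shows "t = s"
proof (rule nat_trans.equality)
  have "nt_at t c = nt_at s c" if "c \<in> Obj C" for c
    using set_map_eqI[OF act_set_map[OF t that] act_set_map[OF s that]] eq[OF that]
    by (simp add: act_def)
  moreover have "nt_at t \<in> extensional (Obj C)" "nt_at s \<in> extensional (Obj C)"
    using t s by (auto simp: PSh_hom_iff is_nat_trans_def opposite_Obj PiE_def)
  ultimately show "nt_at t = nt_at s"
    by (intro extensionalityI)
qed (use t s in \<open>auto simp: PSh_hom_iff\<close>)

lemma mk_map_hom:
  assumes X: "X \<in> Obj (PSh C)" and Y: "Y \<in> Obj (PSh C)"
    and h: "\<And>c x. c \<in> Obj C \<Longrightarrow> x \<in> fobj X c \<Longrightarrow> h c x \<in> fobj Y c"
    and nat: "\<And>c d f x. f \<in> hom C d c \<Longrightarrow> x \<in> fobj X c \<Longrightarrow> h d (res X f x) = res Y f (h c x)"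
  shows "mk_map C X Y h \<in> hom (PSh C) X Y"
proof -
  have "Comp Set_cat (farr Y f) (nt_at (mk_map C X Y h) c) = Comp Set_cat (nt_at (mk_map C X Y h) d) (farr X f)"
    if f: "f \<in> hom C d c" for f c d
    using res_set_map[OF X f] res_set_map[OF Y f] hom_Obj[OF f] h nat[OF f] res_closed[OF X f]
    by (auto simp: mk_map_def Set_Comp Set_hom_iff compose_def res_def)
  then show ?thesis
    using X Y small_fobj h
    by (auto simp: PSh_hom_iff is_nat_trans_def PSh_Obj_iff hom_opposite opposite_Obj mk_map_def Set_hom_iff)
qed

lemma act_mk_map: "c \<in> Obj C \<Longrightarrow> x \<in> fobj X c \<Longrightarrow> act (mk_map C X Y h) c x = h c x"
  by (simp add: mk_map_def act_def)

lemma PSh_Comp_mk_map: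
  assumes t: "t \<in> hom (PSh C) X Y" and s: "s \<in> hom (PSh C) Y Z"
  shows "Comp (PSh C) s t = mk_map C X Z (\<lambda>c x. act s c (act t c x))"
proof -
  have "Comp Set_cat (nt_at s c) (nt_at t c) =
      \<lparr>sm_dom = fobj X c, sm_cod = fobj Z c, sm_fun = (\<lambda>x \<in> fobj X c. act s c (act t c x))\<rparr>"
    if "c \<in> Obj C" for c
    using act_set_map[OF t that] act_set_map[OF s that]
    by (auto simp: Set_Comp Set_hom_iff compose_def act_def)
  moreover have "nt_dom t = X" "nt_cod s = Z"
    using t s by (auto simp: PSh_hom_iff)
  ultimately show ?thesis
    by (auto simp: PSh_def functor_cat_def mk_map_def opposite_Obj)
qed

lemma act_Comp:
  assumes "t \<in> hom (PSh C) X Y" "s \<in> hom (PSh C) Y Z" "c \<in> Obj C" "x \<in> fobj X c"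
  shows "act (Comp (PSh C) s t) c x = act s c (act t c x)"
  using PSh_Comp_mk_map[OF assms(1,2)] assms(3,4) by (simp add: act_mk_map)

lemma PSh_Comp_hom:
  assumes "t \<in> hom (PSh C) X Y" "s \<in> hom (PSh C) Y Z"
  shows "Comp (PSh C) s t \<in> hom (PSh C) X Z"
  unfolding PSh_Comp_mk_map[OF assms]
proof (rule mk_map_hom)
  fix c d f x assume f: "f \<in> hom C d c" and x: "x \<in> fobj X c"
  show "act s d (act t d (res X f x)) = res Z f (act s c (act t c x))"
    using act_natural[OF assms(1) f x] act_natural[OF assms(2) f act_closed[OF assms(1) _ x]]
      hom_Obj[OF f] by simp
qed (use assms PSh_hom_Obj in \<open>auto simp: act_closed\<close>)

lemma PSh_Ide_mk_map: "Ide (PSh C) X = mk_map C X X (\<lambda>c x. x)"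
  by (auto simp: PSh_def functor_cat_def mk_map_def opposite_Obj Set_Ide)

lemma PSh_Ide_hom: "X \<in> Obj (PSh C) \<Longrightarrow> Ide (PSh C) X \<in> hom (PSh C) X X"
  unfolding PSh_Ide_mk_map by (rule mk_map_hom) auto

lemma act_Ide: "c \<in> Obj C \<Longrightarrow> x \<in> fobj X c \<Longrightarrow> act (Ide (PSh C) X) c x = x"
  unfolding PSh_Ide_mk_map by (rule act_mk_map)

lemma category_PSh: "category (PSh C)"
proof
  show "Dom (PSh C) t \<in> Obj (PSh C)" "Cod (PSh C) t \<in> Obj (PSh C)" if "t \<in> Arr (PSh C)" for t
    using PSh_hom_Obj[OF Arr_hom[OF that]] by auto
next
  fix t X Y assume t: "t \<in> hom (PSh C) X Y"
  then have XY: "X \<in> Obj (PSh C)" "Y \<in> Obj (PSh C)" using PSh_hom_Obj by auto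
  note I = PSh_Ide_hom[OF XY(1)] PSh_Ide_hom[OF XY(2)]
  show "Comp (PSh C) (Ide (PSh C) Y) t = t"
    using act_Comp[OF t I(2)] act_Ide act_closed[OF t]
    by (intro PSh_map_eqI[OF PSh_Comp_hom[OF t I(2)] t]) simp
  show "Comp (PSh C) t (Ide (PSh C) X) = t"
    using act_Comp[OF I(1) t] act_Ide
    by (intro PSh_map_eqI[OF PSh_Comp_hom[OF I(1) t] t]) simp
next
  fix t s r W X Y Z
  assume t: "t \<in> hom (PSh C) W X" and s: "s \<in> hom (PSh C) X Y" and r: "r \<in> hom (PSh C) Y Z"
  note st = PSh_Comp_hom[OF t s] and rs = PSh_Comp_hom[OF s r]
  show "Comp (PSh C) r (Comp (PSh C) s t) = Comp (PSh C) (Comp (PSh C) r s) t"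
    using act_Comp[OF t s] act_Comp[OF st r] act_Comp[OF t rs] act_Comp[OF s r] act_closed[OF t]
    by (intro PSh_map_eqI[OF PSh_Comp_hom[OF st r] PSh_Comp_hom[OF t rs]]) simp
qed (use PSh_Ide_hom PSh_Comp_hom in auto)

end

section \<open>The Yoneda lemma\<close>

text \<open>Smallness of the arrows gives representables small values. Together with smallness of
  the objects and the two cardinal conditions it makes categories of elements small.\<close>

locale small_cat = single_typed_cat C for C :: "('v, 'v) cat" +
  assumes infinite_UNIV: "infinite (UNIV :: 'v set)"
    and regular_UNIV: "regularCard |UNIV :: 'v set|"
    and small_Obj: "small (Obj C)"
    and small_Arr: "small (Arr C)"
begin

abbreviation K :: "('v presheaf, 'v presheaf_map) cat" where
  "K \<equiv> PSh C"

sublocale K: category K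
  by (rule category_PSh)

lemma yoneda_eq_mk_psh: "yoneda C c = mk_psh C (\<lambda>d. hom C d c) (\<lambda>f g. Comp C g f)"
  by (simp add: yoneda_def mk_psh_def)

lemma yoneda_Obj: "yoneda C c \<in> Obj K"
  unfolding yoneda_eq_mk_psh
proof (rule mk_psh_Obj)
  show "small (hom C d c)" for d
    by (rule small_subset[OF small_Arr]) (auto simp: hom_def)
qed (use Comp_hom Comp_Ide_right Comp_assoc in auto)

lemma fobj_yoneda: "d \<in> Obj C \<Longrightarrow> fobj (yoneda C c) d = hom C d c"
  by (simp add: yoneda_def)

lemma res_yoneda: "f \<in> hom C e d \<Longrightarrow> g \<in> hom C d c \<Longrightarrow> res (yoneda C c) f g = Comp C g f"
  unfolding yoneda_eq_mk_psh by (rule res_mk_psh)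

text \<open>The map out of y(c) that the Yoneda lemma assigns to x. The inverse assignment is
  evaluation at \<open>Ide C c\<close>, by \<open>act_elem_Ide\<close> and
  \<open>elem_act_Ide\<close>.\<close>

definition elem :: "'v presheaf \<Rightarrow> 'v \<Rightarrow> 'v \<Rightarrow> 'v presheaf_map" where
  "elem X c x = mk_map C (yoneda C c) X (\<lambda>d f. res X f x)"

lemma elem_hom:
  assumes "X \<in> Obj K" "c \<in> Obj C" "x \<in> fobj X c"
  shows "elem X c x \<in> hom K (yoneda C c) X"
  unfolding elem_def
proof (rule mk_map_hom[OF yoneda_Obj assms(1)])
  show "res X f x \<in> fobj X d" if "d \<in> Obj C" "f \<in> fobj (yoneda C c) d" for d f
    using that res_closed[OF assms(1) _ assms(3)] by (simp add: fobj_yoneda)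
  show "res X (res (yoneda C c) f g) x = res X f (res X g x)"
    if "f \<in> hom C e d" "g \<in> fobj (yoneda C c) d" for e d f g
    using that hom_Obj[OF that(1)] res_Comp[OF assms(1) _ that(1) assms(3)]
    by (simp add: fobj_yoneda res_yoneda)
qed

lemma act_elem: "f \<in> hom C d c \<Longrightarrow> act (elem X c x) d f = res X f x"
  using hom_Obj by (simp add: elem_def act_mk_map fobj_yoneda)

lemma act_elem_Ide:
  assumes "X \<in> Obj K" "c \<in> Obj C" "x \<in> fobj X c"
  shows "act (elem X c x) c (Ide C c) = x"
  using assms act_elem[OF Ide_hom] res_Ide by simp

lemma Ide_yoneda: "c \<in> Obj C \<Longrightarrow> Ide C c \<in> fobj (yoneda C c) c"
  by (simp add: fobj_yoneda Ide_hom)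

lemma elem_act_Ide:
  assumes t: "t \<in> hom K (yoneda C c) X" and c: "c \<in> Obj C"
  shows "elem X c (act t c (Ide C c)) = t"
proof (rule PSh_map_eqI[OF elem_hom t])
  show "X \<in> Obj K" using K.hom_Obj[OF t] by simp
  show "act t c (Ide C c) \<in> fobj X c"
    using act_closed[OF t c Ide_yoneda[OF c]] .
  fix d f assume "d \<in> Obj C" "f \<in> fobj (yoneda C c) d"
  then have f: "f \<in> hom C d c" by (simp add: fobj_yoneda)
  show "act (elem X c (act t c (Ide C c))) d f = act t d f"
    using act_natural[OF t f Ide_yoneda[OF c]] res_yoneda[OF f Ide_hom[OF c]] act_elem[OF f]
    by (simp add: Comp_Ide_left[OF f])
qed (fact c)

text \<open>Naturality of the Yoneda bijection in the presheaf. It translates composition with t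
  into the action of t on elements, in both directions of the argument.\<close>

lemma Comp_elem:
  assumes t: "t \<in> hom K X Y" and c: "c \<in> Obj C" and x: "x \<in> fobj X c"
  shows "Comp K t (elem X c x) = elem Y c (act t c x)"
proof -
  have e: "elem X c x \<in> hom K (yoneda C c) X"
    using elem_hom K.hom_Obj[OF t] c x by blast
  have "act (Comp K t (elem X c x)) c (Ide C c) = act t c x"
    using act_Comp[OF e t c Ide_yoneda[OF c]] act_elem_Ide K.hom_Obj[OF t] c x by simp
  then show ?thesis
    using elem_act_Ide[OF K.Comp_hom[OF e t] c] by simp
qed

section \<open>Colimits of presheaves\<close>

text \<open>\<open>equated J D c i x j y\<close> says that \<open>(i, x)\<close> and \<open>(j, y)\<close> are related by the equivalence
  relation generated by \<open>(i, x) \<sim> (j, D(k)(x))\<close>, expressed by quantifying over the functions that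
  are constant along the generating pairs.\<close>

definition compatible :: "('v, 'v) cat \<Rightarrow> ('v, 'v, 'v presheaf, 'v presheaf_map) fctr \<Rightarrow> 'v
    \<Rightarrow> ('v \<Rightarrow> 'v \<Rightarrow> 'v) \<Rightarrow> bool" where
  "compatible J D c g \<longleftrightarrow> (\<forall>i j. \<forall>k \<in> hom J i j. \<forall>x \<in> fobj (fobj D i) c.
    g j (act (farr D k) c x) = g i x)"

definition equated :: "('v, 'v) cat \<Rightarrow> ('v, 'v, 'v presheaf, 'v presheaf_map) fctr \<Rightarrow> 'v
    \<Rightarrow> 'v \<Rightarrow> 'v \<Rightarrow> 'v \<Rightarrow> 'v \<Rightarrow> bool" where
  "equated J D c i x j y \<longleftrightarrow> (\<forall>g. compatible J D c g \<longrightarrow> g i x = g j y)"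

lemma equatedI: "(\<And>g. compatible J D c g \<Longrightarrow> g i x = g j y) \<Longrightarrow> equated J D c i x j y"
  by (simp add: equated_def)

lemma equatedD: "equated J D c i x j y \<Longrightarrow> compatible J D c g \<Longrightarrow> g i x = g j y"
  unfolding equated_def by (drule spec) (drule mp)

lemma equated_sym: "equated J D c i x j y \<Longrightarrow> equated J D c j y i x"
  by (rule equatedI, rule sym, rule equatedD)

lemma equated_trans:
  "equated J D c i x j y \<Longrightarrow> equated J D c j y k z \<Longrightarrow> equated J D c i x k z"
  by (rule equatedI, rule trans, erule (1) equatedD, erule (1) equatedD)

text \<open>At each c, the comparison from the quotient of the disjoint union of the sets D(i)(c) to
  X(c) is bijective. The two clauses are surjectivity and injectivity; well-definedness holds for
  every cocone by \<open>cocone_compatible\<close>.\<close>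

definition pointwise_colimit :: "('v, 'v) cat \<Rightarrow> ('v, 'v, 'v presheaf, 'v presheaf_map) fctr
    \<Rightarrow> 'v presheaf \<Rightarrow> ('v \<Rightarrow> 'v presheaf_map) \<Rightarrow> bool" where
  "pointwise_colimit J D X \<iota> \<longleftrightarrow> (\<forall>c \<in> Obj C.
    (\<forall>x \<in> fobj X c. \<exists>i \<in> Obj J. \<exists>y \<in> fobj (fobj D i) c. act (\<iota> i) c y = x) \<and>
    (\<forall>i \<in> Obj J. \<forall>j \<in> Obj J. \<forall>y \<in> fobj (fobj D i) c. \<forall>z \<in> fobj (fobj D j) c.
      act (\<iota> i) c y = act (\<iota> j) c z \<longrightarrow> equated J D c i y j z))"

text \<open>The legs of a cocone are one of the test functions in the definition of
  \<open>equated\<close>. Hence every cocone identifies equated elements.\<close>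

lemma cocone_compatible:
  assumes "is_cocone J K D X \<iota>" and c: "c \<in> Obj C"
  shows "compatible J D c (\<lambda>i. act (\<iota> i) c)"
  unfolding compatible_def
proof (intro allI ballI)
  fix i j k x assume k: "k \<in> hom J i j" and x: "x \<in> fobj (fobj D i) c"
  have D: "is_functor J K D" and \<iota>: "\<And>j. j \<in> Obj J \<Longrightarrow> \<iota> j \<in> hom K (fobj D j) X"
    and "Comp K (\<iota> j) (farr D k) = \<iota> i"
    using assms(1) k unfolding is_cocone_def by blast+
  moreover interpret J: category J using D by (simp add: is_functor_def)
  have "\<iota> j \<in> hom K (fobj D j) X" using \<iota> J.hom_Obj[OF k] by blast
  ultimately show "act (\<iota> j) c (act (farr D k) c x) = act (\<iota> i) c x"
    using act_Comp[OF functor_hom[OF D k] _ c x] by metis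
qed

lemma is_colimitI:
  assumes cocone: "is_cocone J K D X \<iota>" and pw: "pointwise_colimit J D X \<iota>"
  shows "is_colimit J K D X \<iota>"
  unfolding is_colimit_def
proof (intro conjI allI impI cocone)
  fix Z \<kappa> assume Z: "is_cocone J K D Z \<kappa>"
  have X: "X \<in> Obj K" and \<iota>: "\<And>j. j \<in> Obj J \<Longrightarrow> \<iota> j \<in> hom K (fobj D j) X"
    using cocone by (auto simp: is_cocone_def)
  have Z_Obj: "Z \<in> Obj K" and \<kappa>: "\<And>j. j \<in> Obj J \<Longrightarrow> \<kappa> j \<in> hom K (fobj D j) Z"
    using Z by (auto simp: is_cocone_def)
  have surj: "\<exists>i \<in> Obj J. \<exists>y \<in> fobj (fobj D i) c. act (\<iota> i) c y = x"
    if "c \<in> Obj C" "x \<in> fobj X c" for c x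
    using pw that by (auto simp: pointwise_colimit_def)
  have welldef: "act (\<kappa> i) c y = act (\<kappa> j) c z"
    if "c \<in> Obj C" "i \<in> Obj J" "j \<in> Obj J" "y \<in> fobj (fobj D i) c" "z \<in> fobj (fobj D j) c"
      "act (\<iota> i) c y = act (\<iota> j) c z" for c i j y z
  proof -
    have "equated J D c i y j z"
      using pw that unfolding pointwise_colimit_def by blast
    from equatedD[OF this cocone_compatible[OF Z that(1)]] show ?thesis .
  qed
  \<comment> \<open>The value at x is that of \<kappa> on some preimage of x under the legs; by
    \<open>welldef\<close> it does not depend on the preimage.\<close>
  define w where "w c x = (SOME v. \<exists>i \<in> Obj J. \<exists>y \<in> fobj (fobj D i) c.
      act (\<iota> i) c y = x \<and> v = act (\<kappa> i) c y)" for c x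
  have w: "w c (act (\<iota> i) c y) = act (\<kappa> i) c y"
    if "c \<in> Obj C" "i \<in> Obj J" "y \<in> fobj (fobj D i) c" for c i y
  proof -
    have "\<exists>v. \<exists>j \<in> Obj J. \<exists>z \<in> fobj (fobj D j) c. act (\<iota> j) c z = act (\<iota> i) c y \<and> v = act (\<kappa> j) c z"
      using that by blast
    from someI_ex[OF this] obtain j z where "j \<in> Obj J" "z \<in> fobj (fobj D j) c"
      "act (\<iota> j) c z = act (\<iota> i) c y" "w c (act (\<iota> i) c y) = act (\<kappa> j) c z"
      unfolding w_def[symmetric] by blast
    then show ?thesis
      using welldef[of c j i z y] that by simp
  qed
  define u where "u = mk_map C X Z w"
  have u: "u \<in> hom K X Z"
    unfolding u_def
  proof (rule mk_map_hom[OF X Z_Obj])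
    fix c x assume c: "c \<in> Obj C" and x: "x \<in> fobj X c"
    from surj[OF this] obtain i y where "i \<in> Obj J" "y \<in> fobj (fobj D i) c" "act (\<iota> i) c y = x"
      by blast
    then show "w c x \<in> fobj Z c" using w[OF c, of i y] act_closed[OF \<kappa> c, of i y] by simp
  next
    fix c d f x assume f: "f \<in> hom C d c" and x: "x \<in> fobj X c"
    have cd: "c \<in> Obj C" "d \<in> Obj C" using hom_Obj[OF f] by auto
    from surj[OF cd(1) x] obtain i y where i: "i \<in> Obj J" and y: "y \<in> fobj (fobj D i) c"
      and iy: "act (\<iota> i) c y = x" by blast
    have "fobj D i \<in> Obj K" using K.hom_Obj[OF \<iota>[OF i]] by simp
    then have y': "res (fobj D i) f y \<in> fobj (fobj D i) d" using res_closed f y by blast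
    have "w d (res X f x) = act (\<kappa> i) d (res (fobj D i) f y)"
      using w[OF cd(2) i y'] act_natural[OF \<iota>[OF i] f y] iy by simp
    then show "w d (res X f x) = res Z f (w c x)"
      using act_natural[OF \<kappa>[OF i] f y] w[OF cd(1) i y] iy by simp
  qed
  have act_u: "act u c (act (\<iota> i) c y) = act (\<kappa> i) c y"
    if "c \<in> Obj C" "i \<in> Obj J" "y \<in> fobj (fobj D i) c" for c i y
    using w[OF that] act_mk_map[OF that(1) act_closed[OF \<iota>[OF that(2)] that(1) that(3)]]
    by (simp add: u_def)
  show "\<exists>!u. u \<in> hom K X Z \<and> (\<forall>j \<in> Obj J. Comp K u (\<iota> j) = \<kappa> j)"
  proof (intro ex1I[of _ u] conjI ballI u)
    fix j assume j: "j \<in> Obj J"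
    show "Comp K u (\<iota> j) = \<kappa> j"
      using act_u j act_Comp[OF \<iota>[OF j] u]
      by (intro PSh_map_eqI[OF K.Comp_hom[OF \<iota>[OF j] u] \<kappa>[OF j]]) simp
  next
    fix v assume v: "v \<in> hom K X Z \<and> (\<forall>j \<in> Obj J. Comp K v (\<iota> j) = \<kappa> j)"
    show "v = u"
    proof (rule PSh_map_eqI[OF _ u])
      fix c x assume c: "c \<in> Obj C" and x: "x \<in> fobj X c"
      from surj[OF this] obtain i y where i: "i \<in> Obj J" and y: "y \<in> fobj (fobj D i) c"
        and iy: "act (\<iota> i) c y = x" by blast
      show "act v c x = act u c x"
        using v act_Comp[OF \<iota>[OF i] _ c y, of v Z] act_u[OF c i y] i iy by auto
    qed (use v in simp)
  qed
qed

text \<open>Test functions pull back: precomposing one at d with restriction along f gives one at c,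
  because the maps of the diagram are natural. This makes restriction well defined on
  classes.\<close>

lemma equated_res:
  assumes D: "is_functor J K D" and f: "f \<in> hom C d c"
    and i: "i \<in> Obj J" "x \<in> fobj (fobj D i) c" and j: "j \<in> Obj J" "y \<in> fobj (fobj D j) c"
    and eq: "equated J D c i x j y"
  shows "equated J D d i (res (fobj D i) f x) j (res (fobj D j) f y)"
proof (rule equatedI)
  fix g assume g: "compatible J D d g"
  interpret J: category J using D by (simp add: is_functor_def)
  have "compatible J D c (\<lambda>i x. g i (res (fobj D i) f x))"
    unfolding compatible_def
  proof (intro allI ballI)
    fix i j k x assume k: "k \<in> hom J i j" and x: "x \<in> fobj (fobj D i) c"
    have Di: "fobj D i \<in> Obj K" using functor_obj[OF D] J.hom_Obj[OF k] by simp
    show "g j (res (fobj D j) f (act (farr D k) c x)) = g i (res (fobj D i) f x)"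
      using g k res_closed[OF Di f x] act_natural[OF functor_hom[OF D k] f x]
      unfolding compatible_def by metis
  qed
  from equatedD[OF eq this] show "g i (res (fobj D i) f x) = g j (res (fobj D j) f y)" .
qed

lemma equated_step:
  "k \<in> hom J i j \<Longrightarrow> x \<in> fobj (fobj D i) c \<Longrightarrow> equated J D c j (act (farr D k) c x) i x"
  by (rule equatedI) (simp add: compatible_def)

text \<open>The pointwise quotient of a small diagram is again a presheaf of small sets, so it can be
  compared with any given colimit. Its elements are encoded as chosen representatives.\<close>

lemma is_colimit_pointwise:
  assumes J: "small_category J" and colim: "is_colimit J K D X \<iota>"
  shows "pointwise_colimit J D X \<iota>"
proof -
  have cocone: "is_cocone J K D X \<iota>" using colim by (simp add: is_colimit_def)
  then have D: "is_functor J K D" and X: "X \<in> Obj K"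
    and \<iota>: "\<And>j. j \<in> Obj J \<Longrightarrow> \<iota> j \<in> hom K (fobj D j) X"
    by (auto simp: is_cocone_def)
  interpret J: category J using J by (simp add: small_category_def)
  have Di: "fobj D i \<in> Obj K" if "i \<in> Obj J" for i using functor_obj[OF D that] .
  \<comment> \<open>The predicate under SOME depends only on the class of (i, x), so equated pairs
    receive literally the same representative and classes become elements of \<open>'v\<close> after
    coding.\<close>
  define canon where "canon c i x = (SOME p. fst p \<in> Obj J \<and> snd p \<in> fobj (fobj D (fst p)) c \<and>
      equated J D c i x (fst p) (snd p))" for c i x
  define rep where "rep c i x = pair (canon c i x)" for c i x
  have canon: "fst (canon c i x) \<in> Obj J" "snd (canon c i x) \<in> fobj (fobj D (fst (canon c i x))) c"
    "equated J D c i x (fst (canon c i x)) (snd (canon c i x))"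
    if "i \<in> Obj J" "x \<in> fobj (fobj D i) c" for c i x
  proof -
    have "\<exists>p. fst p \<in> Obj J \<and> snd p \<in> fobj (fobj D (fst p)) c \<and> equated J D c i x (fst p) (snd p)"
      using that by (intro exI[of _ "(i, x)"]) (simp add: equated_def)
    from someI_ex[OF this] show "fst (canon c i x) \<in> Obj J"
      "snd (canon c i x) \<in> fobj (fobj D (fst (canon c i x))) c"
      "equated J D c i x (fst (canon c i x)) (snd (canon c i x))"
      by (auto simp: canon_def)
  qed
  have inv_rep: "inv pair (rep c i x) = canon c i x" for c i x
    using inj_pair[OF infinite_UNIV] by (simp add: rep_def)
  have rep_eq: "rep c i x = rep c j y" if "equated J D c i x j y" for c i j x y
  proof -
    have "equated J D c i x k z = equated J D c j y k z" for k z
      using that equated_sym equated_trans by blast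
    then show ?thesis by (simp add: rep_def canon_def)
  qed
  have rep_eqD: "equated J D c i x j y"
    if "rep c i x = rep c j y" "i \<in> Obj J" "x \<in> fobj (fobj D i) c" "j \<in> Obj J" "y \<in> fobj (fobj D j) c"
    for c i j x y
    using canon(3)[OF that(2,3)] canon(3)[OF that(4,5), THEN equated_sym] that(1)
      inv_rep[of c i x] inv_rep[of c j y] by (simp add: equated_trans)
  define S where "S c = (\<lambda>(i, x). rep c i x) ` Sigma (Obj J) (\<lambda>i. fobj (fobj D i) c)" for c
  \<comment> \<open>Restriction of a class: decode its representative, restrict that, and pass to
    the class at the new object.\<close>
  define r where "r f v = rep (Dom C f) (fst (inv pair v)) (res (fobj D (fst (inv pair v))) f (snd (inv pair v)))"
    for f v
  have r_rep: "r f (rep c i x) = rep d i (res (fobj D i) f x)"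
    if f: "f \<in> hom C d c" and i: "i \<in> Obj J" "x \<in> fobj (fobj D i) c" for f c d i x
    using rep_eq[OF equated_res[OF D f i canon[OF i]]] f by (simp add: r_def inv_rep hom_Dom)
  define Q where "Q = mk_psh C S r"
  have Q: "Q \<in> Obj K"
    unfolding Q_def
  proof (rule mk_psh_Obj)
    fix c assume "c \<in> Obj C"
    then show "small (S c)"
      unfolding S_def using J small_fobj[OF Di]
      by (intro small_Sigma_image[OF infinite_UNIV regular_UNIV]) (auto simp: small_category_def)
  next
    fix c d f v assume f: "f \<in> hom C d c" and "v \<in> S c"
    then obtain i x where "i \<in> Obj J" "x \<in> fobj (fobj D i) c" "v = rep c i x"
      by (auto simp: S_def)
    then show "r f v \<in> S d"
      using r_rep[OF f] res_closed[OF Di f] by (auto simp: S_def)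
  next
    fix c v assume c: "c \<in> Obj C" "v \<in> S c"
    then obtain i x where i: "i \<in> Obj J" "x \<in> fobj (fobj D i) c" and v: "v = rep c i x"
      by (auto simp: S_def)
    show "r (Ide C c) v = v"
      using r_rep[OF Ide_hom[OF c(1)] i] res_Ide[OF Di[OF i(1)] i(2) c(1)] v by simp
  next
    fix c d e f g v assume f: "f \<in> hom C d c" and g: "g \<in> hom C e d" and "v \<in> S c"
    then obtain i x where i: "i \<in> Obj J" "x \<in> fobj (fobj D i) c" and v: "v = rep c i x"
      by (auto simp: S_def)
    show "r (Comp C f g) v = r g (r f v)"
      using res_Comp[OF Di[OF i(1)] f g i(2)] r_rep[OF Comp_hom[OF g f] i] r_rep[OF f i]
        r_rep[OF g i(1) res_closed[OF Di[OF i(1)] f i(2)]] v by simp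
  qed
  have fobj_Q: "fobj Q c = S c" if "c \<in> Obj C" for c
    using that by (simp add: Q_def fobj_mk_psh)
  have rep_S: "rep c i x \<in> S c" if "i \<in> Obj J" "x \<in> fobj (fobj D i) c" for c i x
    using that by (auto simp: S_def)
  have res_Q: "res Q f (rep c i x) = rep d i (res (fobj D i) f x)"
    if "f \<in> hom C d c" "i \<in> Obj J" "x \<in> fobj (fobj D i) c" for f c d i x
    unfolding Q_def using res_mk_psh[where S = S and r = r, OF that(1) rep_S[OF that(2,3)]] r_rep[OF that] by simp
  define \<kappa> where "\<kappa> i = mk_map C (fobj D i) Q (\<lambda>c. rep c i)" for i
  have \<kappa>: "\<kappa> i \<in> hom K (fobj D i) Q" if "i \<in> Obj J" for i
    unfolding \<kappa>_def using that rep_S res_Q by (intro mk_map_hom[OF Di Q]) (auto simp: fobj_Q)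
  have act_\<kappa>: "act (\<kappa> i) c x = rep c i x" if "c \<in> Obj C" "x \<in> fobj (fobj D i) c" for c i x
    unfolding \<kappa>_def using that by (rule act_mk_map)
  have "is_cocone J K D Q \<kappa>"
    unfolding is_cocone_def
  proof (intro conjI ballI allI D Q \<kappa>)
    fix i j k assume k: "k \<in> hom J i j"
    have ij: "i \<in> Obj J" "j \<in> Obj J" using J.hom_Obj[OF k] by auto
    note Dk = functor_hom[OF D k]
    show "Comp K (\<kappa> j) (farr D k) = \<kappa> i"
    proof (rule PSh_map_eqI[OF K.Comp_hom[OF Dk \<kappa>[OF ij(2)]] \<kappa>[OF ij(1)]])
      fix c x assume c: "c \<in> Obj C" and x: "x \<in> fobj (fobj D i) c"
      show "act (Comp K (\<kappa> j) (farr D k)) c x = act (\<kappa> i) c x"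
        using act_Comp[OF Dk \<kappa>[OF ij(2)] c x] act_\<kappa>[OF c] x act_closed[OF Dk c x]
          rep_eq[OF equated_step[where D = D, OF k x]] by simp
    qed
  qed simp
  then have "\<exists>!u. u \<in> hom K X Q \<and> (\<forall>j \<in> Obj J. Comp K u (\<iota> j) = \<kappa> j)"
    using colim unfolding is_colimit_def by blast
  then obtain u where u: "u \<in> hom K X Q" and u_\<iota>: "\<And>j. j \<in> Obj J \<Longrightarrow> Comp K u (\<iota> j) = \<kappa> j"
    by blast
  have act_u: "act u c (act (\<iota> i) c x) = rep c i x"
    if "c \<in> Obj C" "i \<in> Obj J" "x \<in> fobj (fobj D i) c" for c i x
    using act_Comp[OF \<iota>[OF that(2)] u that(1,3)] u_\<iota>[OF that(2)] act_\<kappa> that by simp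
  \<comment> \<open>The comparison back to X evaluates the given cocone at the representative, which
    is legitimate because cocones are constant on classes.\<close>
  define w where "w c v = act (\<iota> (fst (inv pair v))) c (snd (inv pair v))" for c v
  have w_rep: "w c (rep c i x) = act (\<iota> i) c x"
    if "c \<in> Obj C" "i \<in> Obj J" "x \<in> fobj (fobj D i) c" for c i x
    using equatedD[OF canon(3)[OF that(2,3)] cocone_compatible[OF cocone that(1)]]
    by (simp add: w_def inv_rep)
  define v where "v = mk_map C Q X w"
  have v: "v \<in> hom K Q X"
    unfolding v_def
  proof (rule mk_map_hom[OF Q X])
    fix c q assume "c \<in> Obj C" "q \<in> fobj Q c"
    then show "w c q \<in> fobj X c"
      using act_closed[OF \<iota>] w_rep by (auto simp: fobj_Q S_def)
  next
    fix c d f q assume f: "f \<in> hom C d c" and q: "q \<in> fobj Q c"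
    obtain i x where i: "i \<in> Obj J" "x \<in> fobj (fobj D i) c" and qi: "q = rep c i x"
      using q hom_Obj[OF f] by (auto simp: fobj_Q S_def)
    show "w d (res Q f q) = res X f (w c q)"
      using res_Q[OF f i] w_rep[OF _ i] w_rep[OF _ i(1) res_closed[OF Di f i(2)]] i(1)
        act_natural[OF \<iota> f i(2)] hom_Obj[OF f] by (simp add: qi)
  qed
  \<comment> \<open>The endomorphism v u fixes every leg, so uniqueness for the colimit X makes it
    the identity. Then x = v(u(x)) exhibits x as a value of a leg, while injectivity follows from u
    sending the values of the legs to the classes they come from.\<close>
  have "Comp K (Comp K v u) (\<iota> j) = \<iota> j" if j: "j \<in> Obj J" for j
  proof (rule PSh_map_eqI[OF K.Comp_hom[OF \<iota>[OF j] K.Comp_hom[OF u v]] \<iota>[OF j]])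
    fix c x assume c: "c \<in> Obj C" and x: "x \<in> fobj (fobj D j) c"
    show "act (Comp K (Comp K v u) (\<iota> j)) c x = act (\<iota> j) c x"
      using act_Comp[OF \<iota>[OF j] K.Comp_hom[OF u v] c x] act_Comp[OF u v c act_closed[OF \<iota>[OF j] c x]]
        act_u[OF c j x] w_rep[OF c j x] act_mk_map[OF c, of "rep c j x" Q X w] rep_S[OF j x] fobj_Q[OF c]
      by (simp add: v_def)
  qed
  moreover have "\<exists>!u. u \<in> hom K X X \<and> (\<forall>j \<in> Obj J. Comp K u (\<iota> j) = \<iota> j)"
    using colim cocone unfolding is_colimit_def by blast
  moreover have "Comp K (Ide K X) (\<iota> j) = \<iota> j" if "j \<in> Obj J" for j
    using K.Comp_Ide_left[OF \<iota>[OF that]] .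
  ultimately have vu: "Comp K v u = Ide K X"
    using K.Comp_hom[OF u v] K.Ide_hom[OF X] by blast
  show ?thesis
    unfolding pointwise_colimit_def
  proof (intro ballI conjI impI)
    fix c x assume c: "c \<in> Obj C" and x: "x \<in> fobj X c"
    obtain i y where i: "i \<in> Obj J" "y \<in> fobj (fobj D i) c" and ux: "act u c x = rep c i y"
      using act_closed[OF u c x] by (auto simp: fobj_Q[OF c] S_def)
    have "x = act v c (act u c x)"
      using act_Comp[OF u v c x] vu act_Ide[OF c x] by simp
    then have "act (\<iota> i) c y = x"
      using w_rep[OF c i] act_mk_map[OF c, of "rep c i y" Q X w] rep_S[OF i] fobj_Q[OF c] ux
      by (simp add: v_def)
    then show "\<exists>i \<in> Obj J. \<exists>y \<in> fobj (fobj D i) c. act (\<iota> i) c y = x"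
      using i by blast
  next
    fix c i j y z assume "c \<in> Obj C" "i \<in> Obj J" "j \<in> Obj J" "y \<in> fobj (fobj D i) c"
      "z \<in> fobj (fobj D j) c" "act (\<iota> i) c y = act (\<iota> j) c z"
    then show "equated J D c i y j z"
      using act_u[of c i y] act_u[of c j z] rep_eqD[of c i y j z] by simp
  qed
qed

end

section \<open>Representable implies cocontinuous\<close>

context small_cat
begin

text \<open>If E A \<cong> y(d), the elements of P(Y)(c) over A correspond to Y(d), naturally in Y.
  So both clauses of \<open>pointwise_colimit\<close> for the image diagram at c reduce to the
  clauses for D at an object d that varies with A.\<close>

lemma extension_preserves_colimit:
  fixes J :: "('v, 'v) cat"
  assumes P: "is_functor K K P"
    and q: "\<And>X. X \<in> Obj K \<Longrightarrow> q X \<in> hom K (fobj P X) U"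
    and q_nat: "\<And>X Y f. f \<in> hom K X Y \<Longrightarrow> Comp K (q Y) (farr P f) = q X"
    and \<Phi>: "\<And>G A X. A \<in> hom K G U \<Longrightarrow> X \<in> Obj K \<Longrightarrow>
      bij_betw (\<Phi> A X) (hom K (E A) X) {t \<in> hom K G (fobj P X). Comp K (q X) t = A}"
    and \<Phi>_nat: "\<And>G A X Y f h. A \<in> hom K G U \<Longrightarrow> f \<in> hom K X Y \<Longrightarrow> h \<in> hom K (E A) X \<Longrightarrow>
      \<Phi> A Y (Comp K f h) = Comp K (farr P f) (\<Phi> A X h)"
    and rep: "\<And>c A. c \<in> Obj C \<Longrightarrow> A \<in> hom K (yoneda C c) U \<Longrightarrow>
      \<exists>d \<in> Obj C. isomorphic K (E A) (yoneda C d)"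
    and J: "small_category J" and colim: "is_colimit J K D X \<iota>"
  shows "is_colimit J K (fcomp J P D) (fobj P X) (\<lambda>j. farr P (\<iota> j))"
proof (rule is_colimitI)
  have D: "is_functor J K D" and X: "X \<in> Obj K"
    and \<iota>: "\<And>j. j \<in> Obj J \<Longrightarrow> \<iota> j \<in> hom K (fobj D j) X"
    and \<iota>_nat: "\<And>i j k. k \<in> hom J i j \<Longrightarrow> Comp K (\<iota> j) (farr D k) = \<iota> i"
    using colim unfolding is_colimit_def is_cocone_def by blast+
  interpret J: category J using J by (simp add: small_category_def)
  have pw: "pointwise_colimit J D X \<iota>" by (rule is_colimit_pointwise[OF J colim])
  have Di: "fobj D i \<in> Obj K" if "i \<in> Obj J" for i using functor_obj[OF D that] .
  have PD: "fobj (fcomp J P D) i = fobj P (fobj D i)" if "i \<in> Obj J" for i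
    using that by (rule fobj_fcomp)
  have P\<iota>: "farr P (\<iota> j) \<in> hom K (fobj P (fobj D j)) (fobj P X)" if "j \<in> Obj J" for j
    using functor_hom[OF P \<iota>[OF that]] .
  show "is_cocone J K (fcomp J P D) (fobj P X) (\<lambda>j. farr P (\<iota> j))"
    unfolding is_cocone_def
  proof (intro conjI ballI allI)
    show "is_functor J K (fcomp J P D)" by (rule is_functor_fcomp[OF D P])
    show "fobj P X \<in> Obj K" by (rule functor_obj[OF P X])
    show "farr P (\<iota> j) \<in> hom K (fobj (fcomp J P D) j) (fobj P X)" if "j \<in> Obj J" for j
      using P\<iota>[OF that] PD[OF that] by simp
    fix i j k assume k: "k \<in> hom J i j"
    then show "Comp K (farr P (\<iota> j)) (farr (fcomp J P D) k) = farr P (\<iota> i)"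
      using functor_Comp[OF P functor_hom[OF D k] \<iota>[of j]] \<iota>_nat[OF k] J.hom_Obj[OF k]
      by (simp add: farr_fcomp hom_Arr)
  qed
  have fiber: "\<exists>h \<in> hom K (E A) Y. \<Phi> A Y h = t"
    if "A \<in> hom K G U" "t \<in> hom K G (fobj P Y)" "Comp K (q Y) t = A" "Y \<in> Obj K" for A G Y t
  proof -
    have "t \<in> \<Phi> A Y ` hom K (E A) Y"
      using bij_betw_imp_surj_on[OF \<Phi>[OF that(1,4)]] that(2,3) by simp
    then show ?thesis by auto
  qed
  have \<Phi>_hom: "\<Phi> A Y h \<in> hom K G (fobj P Y)" if "A \<in> hom K G U" "h \<in> hom K (E A) Y" "Y \<in> Obj K" for A G Y h
    using bij_betwE[OF \<Phi>[OF that(1,3)]] that(2) by blast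
  have iso: "\<exists>d a b. d \<in> Obj C \<and> a \<in> hom K (yoneda C d) (E A) \<and> b \<in> hom K (E A) (yoneda C d) \<and>
      Comp K a b = Ide K (E A)" if "c \<in> Obj C" "A \<in> hom K (yoneda C c) U" for c A
    using rep[OF that] unfolding isomorphic_def by blast
  \<comment> \<open>A map h out of a retract E' of y(d) is determined by one element of Y(d): Yoneda
    recovers h a from it, and precomposing with b recovers h.\<close>
  have classify: "act (Comp K h a) d (Ide C d) \<in> fobj Y d"
    "Comp K (elem Y d (act (Comp K h a) d (Ide C d))) b = h"
    if d: "d \<in> Obj C" and a: "a \<in> hom K (yoneda C d) E'" and b: "b \<in> hom K E' (yoneda C d)"
      and ab: "Comp K a b = Ide K E'" and h: "h \<in> hom K E' Y" for d a b E' h Y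
  proof -
    note ha = K.Comp_hom[OF a h]
    show "act (Comp K h a) d (Ide C d) \<in> fobj Y d"
      by (rule act_closed[OF ha d Ide_yoneda[OF d]])
    show "Comp K (elem Y d (act (Comp K h a) d (Ide C d))) b = h"
      using elem_act_Ide[OF ha d] K.Comp_assoc[OF b a h] ab K.Comp_Ide_right[OF h] by simp
  qed
  show "pointwise_colimit J (fcomp J P D) (fobj P X) (\<lambda>j. farr P (\<iota> j))"
    unfolding pointwise_colimit_def
  proof (intro ballI conjI impI)
    fix c x assume c: "c \<in> Obj C" and x: "x \<in> fobj (fobj P X) c"
    note PX = functor_obj[OF P X]
    define t where "t = elem (fobj P X) c x"
    have t: "t \<in> hom K (yoneda C c) (fobj P X)" unfolding t_def by (rule elem_hom[OF PX c x])
    define A where "A = Comp K (q X) t"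
    have A: "A \<in> hom K (yoneda C c) U" unfolding A_def by (rule K.Comp_hom[OF t q[OF X]])
    obtain d a b where d: "d \<in> Obj C" and a: "a \<in> hom K (yoneda C d) (E A)"
      and b: "b \<in> hom K (E A) (yoneda C d)" and ab: "Comp K a b = Ide K (E A)"
      using iso[OF c A] by blast
    obtain h where h: "h \<in> hom K (E A) X" and ht: "\<Phi> A X h = t"
      using fiber[OF A t A_def[symmetric] X] by blast
    \<comment> \<open>The colimit X is inspected at d, the object representing E A, and not at
      c.\<close>
    obtain i y where i: "i \<in> Obj J" and y: "y \<in> fobj (fobj D i) d"
      and iy: "act (\<iota> i) d y = act (Comp K h a) d (Ide C d)"
      using pw d classify(1)[OF d a b ab h] unfolding pointwise_colimit_def by blast
    note e = elem_hom[OF Di[OF i] d y]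
    define m where "m = Comp K (elem (fobj D i) d y) b"
    have m: "m \<in> hom K (E A) (fobj D i)" unfolding m_def by (rule K.Comp_hom[OF b e])
    have "Comp K (\<iota> i) m = h"
      using K.Comp_assoc[OF b e \<iota>[OF i]] Comp_elem[OF \<iota>[OF i] d y] iy classify(2)[OF d a b ab h]
      by (simp add: m_def)
    then have t_eq: "t = Comp K (farr P (\<iota> i)) (\<Phi> A (fobj D i) m)"
      using \<Phi>_nat[OF A \<iota>[OF i] m] ht by simp
    note s = \<Phi>_hom[OF A m Di[OF i]]
    have "act (farr P (\<iota> i)) c (act (\<Phi> A (fobj D i) m) c (Ide C c)) = x"
      using act_Comp[OF s P\<iota>[OF i] c Ide_yoneda[OF c]] t_eq act_elem_Ide[OF PX c x] by (simp add: t_def)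
    then show "\<exists>i \<in> Obj J. \<exists>y \<in> fobj (fobj (fcomp J P D) i) c. act (farr P (\<iota> i)) c y = x"
      using act_closed[OF s c Ide_yoneda[OF c]]
      by (intro bexI[OF _ i] bexI[of _ "act (\<Phi> A (fobj D i) m) c (Ide C c)"]) (simp_all add: PD[OF i])
  next
    fix c i j y z assume c: "c \<in> Obj C" and i: "i \<in> Obj J" and j: "j \<in> Obj J"
      and "y \<in> fobj (fobj (fcomp J P D) i) c" "z \<in> fobj (fobj (fcomp J P D) j) c"
      and eq: "act (farr P (\<iota> i)) c y = act (farr P (\<iota> j)) c z"
    then have y: "y \<in> fobj (fobj P (fobj D i)) c" and z: "z \<in> fobj (fobj P (fobj D j)) c"
      using PD by auto
    note PDi = functor_obj[OF P Di[OF i]] and PDj = functor_obj[OF P Di[OF j]]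
    define s where "s = elem (fobj P (fobj D i)) c y"
    define t where "t = elem (fobj P (fobj D j)) c z"
    have s: "s \<in> hom K (yoneda C c) (fobj P (fobj D i))" unfolding s_def by (rule elem_hom[OF PDi c y])
    have t: "t \<in> hom K (yoneda C c) (fobj P (fobj D j))" unfolding t_def by (rule elem_hom[OF PDj c z])
    have st: "Comp K (farr P (\<iota> i)) s = Comp K (farr P (\<iota> j)) t"
      using Comp_elem[OF P\<iota>[OF i] c y] Comp_elem[OF P\<iota>[OF j] c z] eq by (simp add: s_def t_def)
    define A where "A = Comp K (q (fobj D i)) s"
    have A: "A \<in> hom K (yoneda C c) U" unfolding A_def by (rule K.Comp_hom[OF s q[OF Di[OF i]]])
    \<comment> \<open>The elements s and t agree after P(\<iota> i) and P(\<iota> j), which commute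
      with the projections to U. Hence both lie over A and transpose to maps out of the same E
      A.\<close>
    have qt: "Comp K (q (fobj D j)) t = A"
      using q_nat[OF \<iota>[OF i]] q_nat[OF \<iota>[OF j]] K.Comp_assoc[OF s P\<iota>[OF i] q[OF X]]
        K.Comp_assoc[OF t P\<iota>[OF j] q[OF X]] st by (simp add: A_def)
    obtain d a b where d: "d \<in> Obj C" and a: "a \<in> hom K (yoneda C d) (E A)"
      and b: "b \<in> hom K (E A) (yoneda C d)" and ab: "Comp K a b = Ide K (E A)"
      using iso[OF c A] by blast
    obtain h where h: "h \<in> hom K (E A) (fobj D i)" and hs: "\<Phi> A (fobj D i) h = s"
      using fiber[OF A s A_def[symmetric] Di[OF i]] by blast
    obtain h' where h': "h' \<in> hom K (E A) (fobj D j)" and ht: "\<Phi> A (fobj D j) h' = t"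
      using fiber[OF A t qt Di[OF j]] by blast
    note ih = K.Comp_hom[OF h \<iota>[OF i]] and ih' = K.Comp_hom[OF h' \<iota>[OF j]]
    have "\<Phi> A X (Comp K (\<iota> i) h) = \<Phi> A X (Comp K (\<iota> j) h')"
      using \<Phi>_nat[OF A \<iota>[OF i] h] \<Phi>_nat[OF A \<iota>[OF j] h'] st hs ht by simp
    then have hh': "Comp K (\<iota> i) h = Comp K (\<iota> j) h'"
      using bij_betw_imp_inj_on[OF \<Phi>[OF A X]] ih ih' by (auto dest: inj_onD)
    define v where "v = act (Comp K h a) d (Ide C d)"
    define v' where "v' = act (Comp K h' a) d (Ide C d)"
    have v: "v \<in> fobj (fobj D i) d" "Comp K (elem (fobj D i) d v) b = h"
      unfolding v_def using classify[OF d a b ab h] .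
    have v': "v' \<in> fobj (fobj D j) d" "Comp K (elem (fobj D j) d v') b = h'"
      unfolding v'_def using classify[OF d a b ab h'] .
    have "act (\<iota> i) d v = act (Comp K (Comp K (\<iota> i) h) a) d (Ide C d)"
      unfolding v_def using act_Comp[OF K.Comp_hom[OF a h] \<iota>[OF i] d Ide_yoneda[OF d]]
        K.Comp_assoc[OF a h \<iota>[OF i]] by simp
    also have "\<dots> = act (\<iota> j) d v'"
      unfolding v'_def hh' using act_Comp[OF K.Comp_hom[OF a h'] \<iota>[OF j] d Ide_yoneda[OF d]]
        K.Comp_assoc[OF a h' \<iota>[OF j]] by simp
    finally have eqd: "equated J D d i v j v'"
      using pw d i j v(1) v'(1) unfolding pointwise_colimit_def by blast
    show "equated J (fcomp J P D) c i y j z"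
    proof (rule equatedI)
      fix g assume g: "compatible J (fcomp J P D) c g"
      \<comment> \<open>Transport of a test function from the image diagram at c to D at d: an
        element w of D(i)(d) names a map E A \<rightarrow> D(i), whose transpose is an element of
        P(D(i))(c) over A.\<close>
      define g' where "g' i w = g i (act (\<Phi> A (fobj D i) (Comp K (elem (fobj D i) d w) b)) c (Ide C c))" for i w
      have "compatible J D d g'"
        unfolding compatible_def
      proof (intro allI ballI)
        fix i j k w assume k: "k \<in> hom J i j" and w: "w \<in> fobj (fobj D i) d"
        have i: "i \<in> Obj J" using J.hom_Obj[OF k] by simp
        note Dk = functor_hom[OF D k]
        note e = elem_hom[OF Di[OF i] d w]
        note eb = K.Comp_hom[OF b e]
        note \<Phi>e = \<Phi>_hom[OF A eb Di[OF i]]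
        note I = Ide_yoneda[OF c]
        have "Comp K (elem (fobj D j) d (act (farr D k) d w)) b = Comp K (farr D k) (Comp K (elem (fobj D i) d w) b)"
          using Comp_elem[OF Dk d w] K.Comp_assoc[OF b e Dk] by simp
        then have "g' j (act (farr D k) d w) =
            g j (act (farr P (farr D k)) c (act (\<Phi> A (fobj D i) (Comp K (elem (fobj D i) d w) b)) c (Ide C c)))"
          using \<Phi>_nat[OF A Dk eb] act_Comp[OF \<Phi>e functor_hom[OF P Dk] c I] by (simp add: g'_def)
        also have "\<dots> = g' i w"
          using g k act_closed[OF \<Phi>e c I] PD[OF i] unfolding compatible_def g'_def
          by (simp add: farr_fcomp hom_Arr)
        finally show "g' j (act (farr D k) d w) = g' i w" .
      qed
      from equatedD[OF eqd this] show "g i y = g j z"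
        using act_elem_Ide[OF PDi c y] act_elem_Ide[OF PDj c z]
        by (simp add: g'_def v(2) v'(2) hs ht s_def t_def)
    qed
  qed
qed

section \<open>Every presheaf is a small colimit of representables\<close>

text \<open>The category of elements of \<open>E\<close>, with its objects \<open>(c, x)\<close> and arrows
  \<open>(f, x) : (Dom f, x\<cdot>f) \<rightarrow> (Cod f, x)\<close> coded by \<^const>\<open>pair\<close>.\<close>

definition elements :: "'v presheaf \<Rightarrow> ('v, 'v) cat" where
  "elements E = \<lparr>Obj = pair ` (SIGMA c:Obj C. fobj E c),
    Arr = pair ` (SIGMA f:Arr C. fobj E (Cod C f)),
    Dom = (\<lambda>v. case inv pair v of (f, x) \<Rightarrow> pair (Dom C f, res E f x)),
    Cod = (\<lambda>v. case inv pair v of (f, x) \<Rightarrow> pair (Cod C f, x)),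
    Ide = (\<lambda>v. case inv pair v of (c, x) \<Rightarrow> pair (Ide C c, x)),
    Comp = (\<lambda>w v. case inv pair w of (g, y) \<Rightarrow> case inv pair v of (f, x) \<Rightarrow> pair (Comp C g f, y))\<rparr>"

text \<open>On arrows this is y(f): an arrow f : c \<rightarrow> d is an element of y(d)(c), and the
  map it names is postcomposition with f.\<close>

definition elements_diagram :: "'v presheaf \<Rightarrow> ('v, 'v, 'v presheaf, 'v presheaf_map) fctr" where
  "elements_diagram E = \<lparr>fobj = (\<lambda>v \<in> Obj (elements E). yoneda C (fst (inv pair v))),
    farr = (\<lambda>v \<in> Arr (elements E). case inv pair v of (f, x) \<Rightarrow> elem (yoneda C (Cod C f)) (Dom C f) f)\<rparr>"

definition elements_cocone :: "'v presheaf \<Rightarrow> 'v \<Rightarrow> 'v presheaf_map" where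
  "elements_cocone E v = (case inv pair v of (c, x) \<Rightarrow> elem E c x)"

lemma pair_eq_iff: "pair (a :: 'v \<times> 'v) = pair b \<longleftrightarrow> a = b"
  using inj_pair[OF infinite_UNIV] by (simp add: inj_eq)

lemma inv_pair: "inv pair (pair (a :: 'v \<times> 'v)) = a"
  using inj_pair[OF infinite_UNIV] by simp

lemma elements_homE:
  assumes "k \<in> hom (elements E) i j"
  obtains c d f y where "f \<in> hom C c d" "y \<in> fobj E d" "k = pair (f, y)"
    "i = pair (c, res E f y)" "j = pair (d, y)"
proof -
  obtain f y where f: "f \<in> Arr C" and y: "y \<in> fobj E (Cod C f)" and k: "k = pair (f, y)"
    using hom_Arr[OF assms] by (auto simp: elements_def)
  show ?thesis
    using that[OF Arr_hom[OF f] y k] hom_Dom[OF assms] hom_Cod[OF assms] k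
    by (simp add: elements_def inv_pair)
qed

lemma elements_homI:
  "f \<in> hom C c d \<Longrightarrow> y \<in> fobj E d \<Longrightarrow> pair (f, y) \<in> hom (elements E) (pair (c, res E f y)) (pair (d, y))"
  by (auto simp: elements_def hom_def inv_pair)

lemma elements_Comp: "Comp (elements E) (pair (g, y)) (pair (f, x)) = pair (Comp C g f, y)"
  and elements_Ide: "Ide (elements E) (pair (c, x)) = pair (Ide C c, x)"
  by (simp_all add: elements_def inv_pair)

lemma category_elements:
  assumes E: "E \<in> Obj K"
  shows "category (elements E)"
proof
  fix v assume "v \<in> Arr (elements E)"
  from Arr_hom[OF this] obtain c d f y where f: "f \<in> hom C c d" and y: "y \<in> fobj E d"
    and eq: "Dom (elements E) v = pair (c, res E f y)" "Cod (elements E) v = pair (d, y)"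
    by (rule elements_homE)
  have "c \<in> Obj C" "d \<in> Obj C" "res E f y \<in> fobj E c"
    using hom_Obj[OF f] res_closed[OF E f y] by auto
  then show "Dom (elements E) v \<in> Obj (elements E)" "Cod (elements E) v \<in> Obj (elements E)"
    unfolding eq using y by (simp_all add: elements_def)
next
  fix v assume "v \<in> Obj (elements E)"
  then obtain c x where c: "c \<in> Obj C" and x: "x \<in> fobj E c" and v: "v = pair (c, x)"
    by (auto simp: elements_def)
  show "Ide (elements E) v \<in> hom (elements E) v v"
    using elements_homI[where E = E, OF Ide_hom[OF c] x] res_Ide[OF E x c] by (simp add: v elements_Ide)
next
  fix k l u v w assume k: "k \<in> hom (elements E) u v" and l: "l \<in> hom (elements E) v w"
  obtain c d f y where f: "f \<in> hom C c d" and y: "y \<in> fobj E d" and k': "k = pair (f, y)"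
    "u = pair (c, res E f y)" "v = pair (d, y)" using k by (rule elements_homE)
  obtain d' e g z where g: "g \<in> hom C d' e" and z: "z \<in> fobj E e" and l': "l = pair (g, z)"
    "v = pair (d', res E g z)" "w = pair (e, z)" using l by (rule elements_homE)
  have v: "d' = d" "y = res E g z" using k'(3) l'(2) by (auto simp: pair_eq_iff)
  have g: "g \<in> hom C d e" using g v by simp
  show "Comp (elements E) l k \<in> hom (elements E) u w"
    using elements_homI[where E = E, OF Comp_hom[OF f g] z] res_Comp[OF E g f z]
    by (simp add: k' l' v(2) elements_Comp)
next
  fix k u v assume k: "k \<in> hom (elements E) u v"
  obtain c d f y where f: "f \<in> hom C c d" and k': "k = pair (f, y)"
    "u = pair (c, res E f y)" "v = pair (d, y)" using k by (rule elements_homE) blast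
  show "Comp (elements E) (Ide (elements E) v) k = k" "Comp (elements E) k (Ide (elements E) u) = k"
    using Comp_Ide_left[OF f] Comp_Ide_right[OF f] by (simp_all add: k' elements_Comp elements_Ide)
next
  fix k l m u v w x assume k: "k \<in> hom (elements E) u v" and l: "l \<in> hom (elements E) v w"
    and m: "m \<in> hom (elements E) w x"
  obtain c d f y where f: "f \<in> hom C c d" and k': "k = pair (f, y)" "v = pair (d, y)"
    using k by (rule elements_homE) blast
  obtain d' e g z where g: "g \<in> hom C d' e" and l': "l = pair (g, z)" "v = pair (d', res E g z)"
    "w = pair (e, z)" using l by (rule elements_homE) blast
  obtain e' b h t where h: "h \<in> hom C e' b" and m': "m = pair (h, t)" "w = pair (e', res E h t)"
    using m by (rule elements_homE) blast
  have "d' = d" "e' = e" using k'(2) l'(2,3) m'(2) by (auto simp: pair_eq_iff)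
  then show "Comp (elements E) m (Comp (elements E) l k) = Comp (elements E) (Comp (elements E) m l) k"
    using f g h by (simp add: k' l'(1) m'(1) elements_Comp Comp_assoc)
qed

text \<open>Cocontinuity speaks only of index categories that are small and have objects and arrows
  in \<open>'v\<close>; this makes it applicable to the canonical diagram of E.\<close>

lemma small_category_elements:
  assumes E: "E \<in> Obj K"
  shows "small_category (elements E)"
proof -
  have "small (pair ` (SIGMA c:Obj C. fobj E c))"
    using small_fobj[OF E] by (intro small_Sigma_image[OF infinite_UNIV regular_UNIV small_Obj])
  moreover have "small (pair ` (SIGMA f:Arr C. fobj E (Cod C f)))"
    using small_fobj[OF E Cod_Obj] by (intro small_Sigma_image[OF infinite_UNIV regular_UNIV small_Arr])
  ultimately show ?thesis
    using category_elements[OF E] by (simp add: small_category_def elements_def)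
qed

section \<open>Functoriality of the Yoneda embedding and of the canonical diagram\<close>

lemma fobj_elements_diagram:
  "c \<in> Obj C \<Longrightarrow> x \<in> fobj E c \<Longrightarrow> fobj (elements_diagram E) (pair (c, x)) = yoneda C c"
  by (simp add: elements_diagram_def inv_pair elements_def)

lemma farr_elements_diagram:
  "f \<in> hom C c d \<Longrightarrow> x \<in> fobj E d \<Longrightarrow> farr (elements_diagram E) (pair (f, x)) = elem (yoneda C d) c f"
  by (simp add: elements_diagram_def inv_pair elements_def hom_Arr hom_Dom hom_Cod)

lemma elem_yoneda_hom: "f \<in> hom C c d \<Longrightarrow> elem (yoneda C d) c f \<in> hom K (yoneda C c) (yoneda C d)"
  using hom_Obj[of f c d] by (intro elem_hom yoneda_Obj) (auto simp: fobj_yoneda)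

lemma act_elem_yoneda:
  "f \<in> hom C c d \<Longrightarrow> g \<in> hom C b c \<Longrightarrow> act (elem (yoneda C d) c f) b g = Comp C f g"
  by (simp add: act_elem res_yoneda)

lemma Comp_elem_yoneda:
  assumes "f \<in> hom C b c" "g \<in> hom C c d"
  shows "Comp K (elem (yoneda C d) c g) (elem (yoneda C c) b f) = elem (yoneda C d) b (Comp C g f)"
  using Comp_elem[OF elem_yoneda_hom[OF assms(2)], of b f] hom_Obj[OF assms(1)]
    act_elem_yoneda[OF assms(2,1)] assms(1) by (simp add: fobj_yoneda)

lemma elem_yoneda_Ide: "c \<in> Obj C \<Longrightarrow> elem (yoneda C c) c (Ide C c) = Ide K (yoneda C c)"
  using elem_act_Ide[OF K.Ide_hom[OF yoneda_Obj]] act_Ide[OF _ Ide_yoneda] by simp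

lemma is_functor_elements_diagram:
  assumes E: "E \<in> Obj K"
  shows "is_functor (elements E) K (elements_diagram E)"
proof -
  let ?D = "elements_diagram E"
  have hom: "farr ?D k \<in> hom K (fobj ?D u) (fobj ?D v)" if k: "k \<in> hom (elements E) u v" for k u v
  proof -
    obtain c d f y where f: "f \<in> hom C c d" and y: "y \<in> fobj E d" and "k = pair (f, y)"
      "u = pair (c, res E f y)" "v = pair (d, y)" using k by (rule elements_homE) blast
    then show ?thesis
      using elem_yoneda_hom[OF f] hom_Obj[OF f] res_closed[OF E f y]
      by (simp add: fobj_elements_diagram farr_elements_diagram)
  qed
  show ?thesis
    unfolding is_functor_def
  proof (intro conjI ballI allI category_elements[OF E] K.category_axioms hom)
    show "fobj ?D \<in> Obj (elements E) \<rightarrow>\<^sub>E Obj K"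
      by (auto simp: elements_diagram_def yoneda_Obj)
    have "farr ?D k \<in> Arr K" if "k \<in> Arr (elements E)" for k
      using hom_Arr[OF hom[OF Arr_hom[OF that]]] .
    then show "farr ?D \<in> Arr (elements E) \<rightarrow>\<^sub>E Arr K"
      by (intro PiE_I) (simp_all add: elements_diagram_def)
  next
    fix v assume "v \<in> Obj (elements E)"
    then obtain c x where c: "c \<in> Obj C" and x: "x \<in> fobj E c" and v: "v = pair (c, x)"
      by (auto simp: elements_def)
    show "farr ?D (Ide (elements E) v) = Ide K (fobj ?D v)"
      using farr_elements_diagram[where E = E, OF Ide_hom[OF c] x] c x elem_yoneda_Ide[OF c]
      by (simp add: v elements_Ide fobj_elements_diagram)
  next
    fix k l u v w assume k: "k \<in> hom (elements E) u v" and l: "l \<in> hom (elements E) v w"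
    obtain c d f y where f: "f \<in> hom C c d" and y: "y \<in> fobj E d" and k': "k = pair (f, y)"
      "v = pair (d, y)" using k by (rule elements_homE) blast
    obtain d' e g z where g: "g \<in> hom C d' e" and z: "z \<in> fobj E e" and l': "l = pair (g, z)"
      "v = pair (d', res E g z)" using l by (rule elements_homE) blast
    have "d' = d" using k'(2) l'(2) by (auto simp: pair_eq_iff)
    then have g: "g \<in> hom C d e" using g by simp
    show "farr ?D (Comp (elements E) l k) = Comp K (farr ?D l) (farr ?D k)"
      using Comp_elem_yoneda[OF f g] Comp_hom[OF f g] f g y z
      by (simp add: k' l'(1) elements_Comp farr_elements_diagram)
  qed
qed

text \<open>The density theorem. An element f of y(d)(c) sitting over (d, x) has a normal form
  determined by its image in E(c), which gives injectivity; surjectivity is witnessed by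
  identities.\<close>

lemma elements_colimit:
  assumes E: "E \<in> Obj K"
  shows "is_colimit (elements E) K (elements_diagram E) E (elements_cocone E)"
proof (rule is_colimitI)
  let ?D = "elements_diagram E"
  have \<iota>: "elements_cocone E (pair (c, x)) = elem E c x" for c x
    by (simp add: elements_cocone_def inv_pair)
  show "is_cocone (elements E) K ?D E (elements_cocone E)"
    unfolding is_cocone_def
  proof (intro conjI ballI allI is_functor_elements_diagram[OF E] E)
    fix v assume "v \<in> Obj (elements E)"
    then obtain c x where c: "c \<in> Obj C" and x: "x \<in> fobj E c" and v: "v = pair (c, x)"
      by (auto simp: elements_def)
    show "elements_cocone E v \<in> hom K (fobj ?D v) E"
      using elem_hom[OF E c x] fobj_elements_diagram[OF c x] by (simp add: v \<iota>)
  next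
    fix k u v assume k: "k \<in> hom (elements E) u v"
    obtain c d f y where f: "f \<in> hom C c d" and y: "y \<in> fobj E d" and eq: "k = pair (f, y)"
      "u = pair (c, res E f y)" "v = pair (d, y)" using k by (rule elements_homE) blast
    have cd: "c \<in> Obj C" "d \<in> Obj C" using hom_Obj[OF f] by auto
    show "Comp K (elements_cocone E v) (farr ?D k) = elements_cocone E u"
      using Comp_elem[OF elem_hom[OF E cd(2) y] cd(1), of f] f act_elem[OF f]
        farr_elements_diagram[OF f y] cd by (simp add: eq \<iota> fobj_yoneda)
  qed
  show "pointwise_colimit (elements E) ?D E (elements_cocone E)"
    unfolding pointwise_colimit_def
  proof (intro ballI conjI impI)
    fix c x assume c: "c \<in> Obj C" and x: "x \<in> fobj E c"
    have "pair (c, x) \<in> Obj (elements E)" using c x by (simp add: elements_def)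
    then show "\<exists>v \<in> Obj (elements E). \<exists>y \<in> fobj (fobj ?D v) c. act (elements_cocone E v) c y = x"
      using act_elem_Ide[OF E c x] Ide_yoneda[OF c] fobj_elements_diagram[OF c x]
      by (intro bexI[of _ "pair (c, x)"] bexI[of _ "Ide C c"]) (simp_all add: \<iota>)
  next
    fix c u v f g assume c: "c \<in> Obj C" and u: "u \<in> Obj (elements E)" and v: "v \<in> Obj (elements E)"
      and fg: "f \<in> fobj (fobj ?D u) c" "g \<in> fobj (fobj ?D v) c"
      and eq: "act (elements_cocone E u) c f = act (elements_cocone E v) c g"
    \<comment> \<open>The arrow (f, x) of the category of elements carries the identity of c to f.
      Two such steps meet as soon as the restrictions of x along f and of y along g
      coincide.\<close>
    have *: "equated (elements E) ?D c (pair (d, x)) f (pair (c, res E f x)) (Ide C c)"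
      if f: "f \<in> hom C c d" and x: "x \<in> fobj E d" for d x f
    proof -
      have "act (farr ?D (pair (f, x))) c (Ide C c) = f"
        using act_elem_yoneda[OF f Ide_hom[OF c]] farr_elements_diagram[OF f x] Comp_Ide_right[OF f]
        by simp
      then show ?thesis
        using equated_step[where D = "?D" and c = c and x = "Ide C c", OF elements_homI[where E = E, OF f x]]
          fobj_elements_diagram[OF c res_closed[OF E f x]] Ide_yoneda[OF c] by simp
    qed
    obtain d x where d: "d \<in> Obj C" and x: "x \<in> fobj E d" and u: "u = pair (d, x)"
      using u by (auto simp: elements_def)
    obtain e y where e: "e \<in> Obj C" and y: "y \<in> fobj E e" and v: "v = pair (e, y)"
      using v by (auto simp: elements_def)
    have f: "f \<in> hom C c d" and g: "g \<in> hom C c e"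
      using fg c d e x y by (simp_all add: u v fobj_elements_diagram fobj_yoneda)
    have "res E f x = res E g y"
      using eq act_elem[OF f] act_elem[OF g] by (simp add: u v \<iota>)
    then show "equated (elements E) ?D c u f v g"
      using
        equated_trans[OF *[OF f x], of v g] equated_sym[OF *[OF g y]] by (simp add: u v)
  qed
qed

section \<open>Cocontinuous implies representable\<close>

text \<open>By fullness of Yoneda the idempotent h k of y(d) is y(e), and by faithfulness e is
  idempotent. Splitting e yields a second splitting of h k, through y(w), and the objects through
  which an idempotent splits are isomorphic.\<close>

lemma retract_of_representable:
  assumes cc: "cauchy_complete C" and d: "d \<in> Obj C"
    and h: "h \<in> hom K E (yoneda C d)" and k: "k \<in> hom K (yoneda C d) E"
    and kh: "Comp K k h = Ide K E"
  shows "\<exists>w \<in> Obj C. isomorphic K E (yoneda C w)"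
proof -
  define e where "e = act (Comp K h k) d (Ide C d)"
  note hk = K.Comp_hom[OF k h]
  have e: "e \<in> hom C d d"
    using act_closed[OF hk d Ide_yoneda[OF d]] d by (simp add: e_def fobj_yoneda)
  have elem_e: "elem (yoneda C d) d e = Comp K h k"
    unfolding e_def by (rule elem_act_Ide[OF hk d])
  have "Comp K (Comp K h k) (Comp K h k) = Comp K h k"
    using K.Comp_assoc[OF k h hk] K.Comp_assoc[OF h k h] kh K.Comp_Ide_right[OF h] by simp
  then have "elem (yoneda C d) d (Comp C e e) = elem (yoneda C d) d e"
    using Comp_elem_yoneda[OF e e] elem_e by simp
  \<comment> \<open>Faithfulness of Yoneda, seen by evaluating both maps at the identity of
    d.\<close>
  then have "Comp C e e = e"
    using act_elem_yoneda[OF Comp_hom[OF e e] Ide_hom[OF d]] act_elem_yoneda[OF e Ide_hom[OF d]]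
      Comp_Ide_right[OF Comp_hom[OF e e]] Comp_Ide_right[OF e] by simp
  then obtain w r s where w: "w \<in> Obj C" and r: "r \<in> hom C d w" and s: "s \<in> hom C w d"
    and rs: "Comp C r s = Ide C w" and sr: "Comp C s r = e"
    using cc d e unfolding cauchy_complete_def by blast
  define yr where "yr = elem (yoneda C w) d r"
  define ys where "ys = elem (yoneda C d) w s"
  have yr: "yr \<in> hom K (yoneda C d) (yoneda C w)" unfolding yr_def by (rule elem_yoneda_hom[OF r])
  have ys: "ys \<in> hom K (yoneda C w) (yoneda C d)" unfolding ys_def by (rule elem_yoneda_hom[OF s])
  have yrs: "Comp K yr ys = Ide K (yoneda C w)"
    unfolding yr_def ys_def using Comp_elem_yoneda[OF s r] rs elem_yoneda_Ide[OF w] by simp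
  have ysr: "Comp K ys yr = Comp K h k"
    unfolding yr_def ys_def using Comp_elem_yoneda[OF r s] sr elem_e by simp
  \<comment> \<open>The usual comparison of two splittings: the section of one followed by the
    retraction of the other.\<close>
  define a where "a = Comp K yr h"
  define b where "b = Comp K k ys"
  have a: "a \<in> hom K E (yoneda C w)" unfolding a_def by (rule K.Comp_hom[OF h yr])
  have b: "b \<in> hom K (yoneda C w) E" unfolding b_def by (rule K.Comp_hom[OF ys k])
  have "Comp K b a = Comp K k (Comp K (Comp K ys yr) h)"
    unfolding a_def b_def using K.Comp_assoc[OF K.Comp_hom[OF h yr] ys k] K.Comp_assoc[OF h yr ys]
    by simp
  also have "\<dots> = Ide K E"
    using ysr K.Comp_assoc[OF h k h] kh K.Comp_Ide_right[OF h] by simp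
  finally have ba: "Comp K b a = Ide K E" .
  have "Comp K a b = Comp K yr (Comp K (Comp K h k) ys)"
    unfolding a_def b_def using K.Comp_assoc[OF b[unfolded b_def] h yr] K.Comp_assoc[OF ys k h]
    by simp
  also have "\<dots> = Ide K (yoneda C w)"
    using K.Comp_assoc[OF ys yr ys] yrs K.Comp_Ide_right[OF ys] ysr by simp
  finally have ab: "Comp K a b = Ide K (yoneda C w)" .
  show ?thesis
    using w a b ab ba unfolding isomorphic_def by blast
qed

text \<open>Here c and A are fixed and \<open>\<Phi>\<close> is the transposition at that A, with E
  the pullback belonging to it.\<close>

lemma cocontinuous_imp_representable_fiber:
  assumes P: "cocontinuous C P"
    and q: "\<And>X. X \<in> Obj K \<Longrightarrow> q X \<in> hom K (fobj P X) U"
    and q_nat: "\<And>X Y f. f \<in> hom K X Y \<Longrightarrow> Comp K (q Y) (farr P f) = q X"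
    and \<Phi>: "\<And>X. X \<in> Obj K \<Longrightarrow>
      bij_betw (\<Phi> X) (hom K E X) {t \<in> hom K (yoneda C c) (fobj P X). Comp K (q X) t = A}"
    and \<Phi>_nat: "\<And>X Y f h. f \<in> hom K X Y \<Longrightarrow> h \<in> hom K E X \<Longrightarrow>
      \<Phi> Y (Comp K f h) = Comp K (farr P f) (\<Phi> X h)"
    and c: "c \<in> Obj C" and A: "A \<in> hom K (yoneda C c) U" and E: "E \<in> Obj K"
    and cc: "cauchy_complete C"
  shows "\<exists>d \<in> Obj C. isomorphic K E (yoneda C d)"
proof -
  let ?D = "elements_diagram E" and ?\<iota> = "elements_cocone E"
  have PF: "is_functor K K P" using P by (simp add: cocontinuous_def)
  have "is_colimit (elements E) K (fcomp (elements E) P ?D) (fobj P E) (\<lambda>j. farr P (?\<iota> j))"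
    using P small_category_elements[OF E] elements_colimit[OF E]
    unfolding cocontinuous_def preserves_colimits_def by blast
  from is_colimit_pointwise[OF small_category_elements[OF E] this]
  have surj: "\<exists>i \<in> Obj (elements E). \<exists>y \<in> fobj (fobj (fcomp (elements E) P ?D) i) c.
      act (farr P (?\<iota> i)) c y = x" if "x \<in> fobj (fobj P E) c" for x
    using that c unfolding pointwise_colimit_def by blast
  \<comment> \<open>The generic element over A: by naturality every other one is
    \<open>Comp K (farr P h) t\<close> for a map h out of E.\<close>
  define t where "t = \<Phi> E (Ide K E)"
  have t: "t \<in> hom K (yoneda C c) (fobj P E)" "Comp K (q E) t = A"
    using bij_betwE[OF \<Phi>[OF E]] K.Ide_hom[OF E] by (auto simp: t_def)
  obtain i y where i: "i \<in> Obj (elements E)" and y: "y \<in> fobj (fobj (fcomp (elements E) P ?D) i) c"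
    and iy: "act (farr P (?\<iota> i)) c y = act t c (Ide C c)"
    using surj[OF act_closed[OF t(1) c Ide_yoneda[OF c]]] by blast
  obtain d x where d: "d \<in> Obj C" and x: "x \<in> fobj E d" and i': "i = pair (d, x)"
    using i by (auto simp: elements_def)
  define k where "k = elem E d x"
  have k: "k \<in> hom K (yoneda C d) E" unfolding k_def by (rule elem_hom[OF E d x])
  have \<iota>i: "?\<iota> i = k" by (simp add: i' k_def elements_cocone_def inv_pair)
  have y: "y \<in> fobj (fobj P (yoneda C d)) c"
    using y i fobj_elements_diagram[OF d x] by (simp add: fobj_fcomp i')
  note Pk = functor_hom[OF PF k]
  define s where "s = elem (fobj P (yoneda C d)) c y"
  have s: "s \<in> hom K (yoneda C c) (fobj P (yoneda C d))"
    unfolding s_def by (rule elem_hom[OF functor_obj[OF PF yoneda_Obj] c y])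
  have ks: "Comp K (farr P k) s = t"
    using Comp_elem[OF Pk c y] iy elem_act_Ide[OF t(1) c] by (simp add: s_def \<iota>i)
  \<comment> \<open>The lift s lies over the same A as t because P(k) commutes with the projections.
    This is what lets s transpose to a map out of the same E, giving the section h of k.\<close>
  then have "Comp K (q (yoneda C d)) s = A"
    using q_nat[OF k] K.Comp_assoc[OF s Pk q[OF E]] t(2) by simp
  then have "s \<in> \<Phi> (yoneda C d) ` hom K E (yoneda C d)"
    using bij_betw_imp_surj_on[OF \<Phi>[OF yoneda_Obj[of d]]] s by simp
  then obtain h where h: "h \<in> hom K E (yoneda C d)" and hs: "\<Phi> (yoneda C d) h = s"
    by auto
  have "\<Phi> E (Comp K k h) = \<Phi> E (Ide K E)"
    using \<Phi>_nat[OF k h] hs ks by (simp add: t_def)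
  then have "Comp K k h = Ide K E"
    using bij_betw_imp_inj_on[OF \<Phi>[OF E]] K.Comp_hom[OF h k] K.Ide_hom[OF E]
    by (auto dest: inj_onD)
  from retract_of_representable[OF cc d h k this] show ?thesis .
qed

section \<open>Both implications for an arbitrary choice of extension\<close>

lemma
  assumes ext: "is_extension K p P"
  shows representable_imp_cocontinuous: "representable C p \<Longrightarrow> cocontinuous C P"
    and cocontinuous_imp_representable: "cocontinuous C P \<Longrightarrow> cauchy_complete C \<Longrightarrow> representable C p"
proof -
  have P: "is_functor K K P" by (rule is_functor_extension[OF ext])
  obtain q E \<pi>\<^sub>1 \<pi>\<^sub>2 \<Phi> where
    q: "\<And>X. X \<in> Obj K \<Longrightarrow> q X \<in> hom K (fobj P X) (Cod K p)" and
    q_nat: "\<And>X Y f. f \<in> hom K X Y \<Longrightarrow> Comp K (q Y) (farr P f) = q X" and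
    pb: "\<And>G A. A \<in> hom K G (Cod K p) \<Longrightarrow> is_pullback K A p (E A) (\<pi>\<^sub>1 A) (\<pi>\<^sub>2 A)" and
    \<Phi>: "\<And>G A X. A \<in> hom K G (Cod K p) \<Longrightarrow> X \<in> Obj K \<Longrightarrow>
      bij_betw (\<Phi> A X) (hom K (E A) X) {t \<in> hom K G (fobj P X). Comp K (q X) t = A}" and
    \<Phi>_nat: "\<And>G A X Y f h. A \<in> hom K G (Cod K p) \<Longrightarrow> f \<in> hom K X Y \<Longrightarrow> h \<in> hom K (E A) X \<Longrightarrow>
      \<Phi> A Y (Comp K f h) = Comp K (farr P f) (\<Phi> A X h)"
    by (rule extension_polynomial[OF ext]) blast
  {
    assume rep: "representable C p"
    have fiber: "\<exists>d \<in> Obj C. isomorphic K (E A) (yoneda C d)"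
      if c: "c \<in> Obj C" and A: "A \<in> hom K (yoneda C c) (Cod K p)" for c A
    proof -
      obtain E' \<rho>\<^sub>1 \<rho>\<^sub>2 d where "is_pullback K A p E' \<rho>\<^sub>1 \<rho>\<^sub>2" and d: "d \<in> Obj C"
        and E': "isomorphic K E' (yoneda C d)"
        using rep c A unfolding representable_def by blast
      from K.pullback_unique[OF pb[OF A] this(1)] show ?thesis
        using K.isomorphic_trans[OF _ E'] d by blast
    qed
    show "cocontinuous C P"
      unfolding cocontinuous_def preserves_colimits_def
      by (intro conjI allI impI P) (rule extension_preserves_colimit[OF P q q_nat \<Phi> \<Phi>_nat fiber])
  }
  {
    assume P: "cocontinuous C P" and cc: "cauchy_complete C"
    show "representable C p"
      unfolding representable_def
    proof (intro ballI)
      fix c A assume c: "c \<in> Obj C" and A: "A \<in> hom K (yoneda C c) (Cod K p)"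
      have E: "E A \<in> Obj K" using pb[OF A] by (simp add: is_pullback_def)
      have "\<exists>d \<in> Obj C. isomorphic K (E A) (yoneda C d)"
        by (rule cocontinuous_imp_representable_fiber[OF P q q_nat \<Phi>[OF A] \<Phi>_nat[OF A] c A E cc])
      then show "\<exists>E \<pi>\<^sub>1 \<pi>\<^sub>2. is_pullback K A p E \<pi>\<^sub>1 \<pi>\<^sub>2 \<and> (\<exists>d \<in> Obj C. isomorphic K E (yoneda C d))"
        using pb[OF A] by blast
    qed
  }
qed

end

theorem theorem3p3p5:
  fixes C :: "('v, 'v) cat"
    and p :: "'v presheaf_map"
    and P :: "('v presheaf, 'v presheaf_map, 'v presheaf, 'v presheaf_map) fctr"
  assumes "infinite (UNIV :: 'v set)"
    and "regularCard |UNIV :: 'v set|"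
    and "small_category C"
    and "p \<in> Arr (PSh C)"
    and "is_extension (PSh C) p P"
  shows "(representable C p \<longrightarrow> cocontinuous C P) \<and>
    (cocontinuous C P \<and> cauchy_complete C \<and> has_finite_products C \<longrightarrow> representable C p)"
proof -
  interpret small_cat C
    using assms(1-3)
    by (simp add: small_cat_def small_cat_axioms_def single_typed_cat_def small_category_def)
  show ?thesis
    using representable_imp_cocontinuous[OF assms(5)] cocontinuous_imp_representable[OF assms(5)]
    by blast
qed

end
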